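(* (Hard-thresholding with consistent tuning) Suppose that for given $i\ge1$ satisfying $i\le k=k(n)$ for large enough $n$ we have $\xi_{i,n}\eta_{i,n}\to0$ and $n^{1/2}\eta_{i,n}\to\infty$. Set the scaling factor $\alpha_{i,n}=(\xi_{i,n}\eta_{i,n})^{-1}$. Suppose that the true parameters $\theta^{(n)}=(\theta_{1,n},\dots,\theta_{k_n,n})\in\mathbb{R}^{k_n}$ (with $k_n=k(n)$) and $\sigma_n\in(0,\infty)$ satisfy $\theta_{i,n}/(\sigma_n\xi_{i,n}\eta_{i,n})\to\zeta_i\in\bar{\mathbb{R}}$. Let $H_n$ denote the cdf of $\sigma_n^{-1}\alpha_{i,n}(\tilde\theta_{H,i}-\theta_{i,n})$ under $P_{n,\theta^{(n)},\sigma_n}$. (a) If $n-k$ is eventually constant equal to $m$, say, then $H_n$ converges weakly to $$\left(\int_{|\zeta_i|}^\infty\rho_m(s)\,ds\right)\delta_{-\zeta_i}+\left(1-\int_{|\zeta_i|}^\infty\rho_m(s)\,ds\right)\delta_0=\Pr(\chi_m^2>m\zeta_i^2)\delta_{-\zeta_i}+\Pr(\chi_m^2\le m\zeta_i^2)\delta_0.$$ (This reduces to $\delta_0$ for $|\zeta_i|=\infty$.) (b) If $n-k\to\infty$, then, with $r_{i,n}=n^{1/2}\left(\eta_{i,n}-\zeta_i\theta_{i,n}/(\sigma_n\xi_{i,n})\right)$ (used only when $|\zeta_i|=1$): 1. $|\zeta_i|<1$ implies that $H_n$ converges weakly to $\delta_{-\zeta_i}$. 2. $|\zeta_i|>1$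 implies that $H_n$ converges weakly to $\delta_0$. 3. $|\zeta_i|=1$ and $n^{1/2}\eta_{i,n}/(n-k)^{1/2}\to0$ imply that $H_n$ converges weakly to $\Phi(r_i)\delta_{-\zeta_i}+(1-\Phi(r_i))\delta_0$ provided $r_{i,n}\to r_i$ for some $r_i\in\bar{\mathbb{R}}$. 4. $|\zeta_i|=1$ and $n^{1/2}\eta_{i,n}/(n-k)^{1/2}\to2^{1/2}d_i$ with $0<d_i<\infty$ imply that $H_n$ converges weakly to $$\left(\int_{-\infty}^\infty\Phi(d_it+r_i)\phi(t)\,dt\right)\delta_{-\zeta_i}+\left(1-\int_{-\infty}^\infty\Phi(d_it+r_i)\phi(t)\,dt\right)\delta_0$$ provided $r_{i,n}\to r_i$ for some $r_i\in\bar{\mathbb{R}}$. (This reduces to $\delta_{-\zeta_i}$ if $r_i=\infty$, and to $\delta_0$ if $r_i=-\infty$.) 5. $|\zeta_i|=1$ and $n^{1/2}\eta_{i,n}/(n-k)^{1/2}\to\infty$ imply that $H_n$ converges weakly to $\Phi(r_i')\delta_{-\zeta_i}+(1-\Phi(r_i'))\delta_0$ provided $\left(n^{1/2}\eta_{i,n}/(n-k)^{1/2}\right)^{-1}r_{i,n}\to2^{-1/2}r_i'$ for some $r_i'\in\bar{\mathbb{R}}$.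
   Context: For each sample size $n$ consider the linear regression model $Y=X\theta+u$, where $X$ is a nonstochastic $n\times k$ matrix of rank $k\ge1$ with $k<n$, $\theta\in\mathbb{R}^k$, $u\sim N(0,\sigma^2I_n)$, $0<\sigma<\infty$. The number $k=k(n)$, the entries of $X,Y,u$ and the underlying probability space may depend on $n$. $P_{n,\theta,\sigma}$ denotes probability under parameters $\theta,\sigma$. $X'$ is the transpose of $X$. $\xi_{i,n}$ is the nonnegative square root of the $i$-th diagonal element of $(X'X/n)^{-1}$. $\hat\theta_{LS}=(X'X)^{-1}X'Y$ with $i$-th component $\hat\theta_{LS,i}$, and $\hat\sigma^2=(n-k)^{-1}(Y-X\hat\theta_{LS})'(Y-X\hat\theta_{LS})$, $\hat\sigma\ge0$. The tuning parameters $\eta_{i,n}$ are positive real numbers. The hard-thresholding estimator is $\tilde\theta_{H,i}=\hat\theta_{LS,i}\mathbf{1}(|\hat\theta_{LS,i}|>\hat\sigma\xi_{i,n}\eta_{i,n})$. Standing assumption for all asymptotics: $\sup_n\xi_{j,n}^2/n<\infty$ for every fixed $j\ge1$ satisfying $j\le k(n)$ for large enough $n$. $\Phi,\phi$ are the standard normal cdf and pdf, $\Phi(\infty)=1$, $\Phi(-\infty)=0$; $\bar{\mathbb{R}}=\mathbb{R}\cup\{-\infty,\infty\}$; $\delta_z$ is pointmass at $z$. $\chi_m^2$ denotes a chi-square random variable with $m$ degrees of freedom; $\rho_m$ is the density of $m^{-1/2}$ times the square root of a $\chi_m^2$ random variable, with $\rho_m(s)=0$ for $s<0$. *)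

theory Defs
  imports "HOL-Probability.Probability" "Jordan_Normal_Form.DL_Rank"
    "Jordan_Normal_Form.Gauss_Jordan_Elimination"
begin

no_notation vec_nth (infixl "$" 90)

subsection \<open>Estimators in the linear regression model\<close>

text \<open>The numbers of observations and of regressors are read off from the design matrix.
  Components of parameter vectors are numbered from 1, whereas the indices of the matrix library
  start at 0.\<close>

definition xi :: "real mat \<Rightarrow> nat \<Rightarrow> real" where
  "xi X i = sqrt (the (mat_inverse ((1 / real (dim_row X)) \<cdot>\<^sub>m (transpose_mat X * X))) $$ (i - 1, i - 1))"

definition theta_LS :: "real mat \<Rightarrow> real vec \<Rightarrow> real vec" where
  "theta_LS X Y = the (mat_inverse (transpose_mat X * X)) *\<^sub>v (transpose_mat X *\<^sub>v Y)"

definition sigma_hat :: "real mat \<Rightarrow> real vec \<Rightarrow> real" where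
  "sigma_hat X Y =
     sqrt (((Y - X *\<^sub>v theta_LS X Y) \<bullet> (Y - X *\<^sub>v theta_LS X Y)) / real (dim_row X - dim_col X))"

definition theta_H :: "real mat \<Rightarrow> real \<Rightarrow> nat \<Rightarrow> real vec \<Rightarrow> real" where
  "theta_H X eta i Y =
     theta_LS X Y $ (i - 1) *
       (if \<bar>theta_LS X Y $ (i - 1)\<bar> > sigma_hat X Y * xi X i * eta then 1 else 0)"

text \<open>The random vector \<open>u\<close> is distributed as \<open>N(0, \<sigma>\<^sup>2 I\<^sub>n)\<close>; note that
  \<^const>\<open>normal_density\<close> is parametrised by the standard deviation.\<close>

definition gaussian_errors :: "'w measure \<Rightarrow> nat \<Rightarrow> real \<Rightarrow> ('w \<Rightarrow> real vec) \<Rightarrow> bool" where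
  "gaussian_errors M n \<sigma> u \<longleftrightarrow>
     (\<forall>\<omega>\<in>space M. u \<omega> \<in> carrier_vec n) \<and>
     prob_space.indep_vars M (\<lambda>_. borel) (\<lambda>j \<omega>. u \<omega> $ j) {..<n} \<and>
     (\<forall>j<n. distributed M lborel (\<lambda>\<omega>. u \<omega> $ j) (\<lambda>x. ennreal (normal_density 0 \<sigma> x)))"

subsection \<open>Distributions appearing in the limits\<close>

definition Phi :: "ereal \<Rightarrow> real" where
  "Phi x = (case x of ereal r \<Rightarrow> cdf std_normal_distribution r | PInfty \<Rightarrow> 1 | MInfty \<Rightarrow> 0)"

definition chi_square :: "nat \<Rightarrow> real measure" where
  "chi_square m = distr (\<Pi>\<^sub>M j\<in>{..<m}. std_normal_distribution) borel (\<lambda>x. \<Sum>j<m. (x j)\<^sup>2)"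

definition chi_scaled :: "nat \<Rightarrow> real measure" where
  "chi_scaled m = distr (chi_square m) borel (\<lambda>x. sqrt x / sqrt (real m))"

text \<open>For \<open>m \<ge> 1\<close> the law \<open>chi_scaled m\<close> is absolutely continuous with respect
  to Lebesgue measure, so its Radon-Nikodym derivative is a density. It is determined only almost
  everywhere; \<open>rho\<close> is used only under integrals.\<close>

definition rho :: "nat \<Rightarrow> real \<Rightarrow> real" where
  "rho m s = (if s < 0 then 0 else enn2real (RN_deriv lborel (chi_scaled m) s))"

text \<open>Point mass at an extended real, seen as a measure on the reals: a mass located at
  \<open>\<infinity>\<close> or \<open>-\<infinity>\<close> is lost. Hence a mixture one of whose atoms is
  infinite is a probability measure only if that atom has weight zero.\<close>

definition pointmass :: "ereal \<Rightarrow> real measure" where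
  "pointmass z = (if \<bar>z\<bar> = \<infinity> then null_measure borel else return borel (real_of_ereal z))"

definition mixture :: "real \<Rightarrow> real measure \<Rightarrow> real \<Rightarrow> real measure \<Rightarrow> real measure" where
  "mixture a M b N =
     measure_of UNIV (sets borel) (\<lambda>A. ennreal a * emeasure M A + ennreal b * emeasure N A)"

lemma sets_mixture [simp]: "sets (mixture a M b N) = sets borel"
  unfolding mixture_def using sets.sigma_sets_eq[of "borel :: real measure"] by (simp add: sets_measure_of)

lemma emeasure_mixture:
  assumes M: "sets M = sets borel" and N: "sets N = sets borel" and A: "A \<in> sets borel"
  shows "emeasure (mixture a M b N) A = ennreal a * emeasure M A + ennreal b * emeasure N A"
  unfolding mixture_def
proof (rule emeasure_measure_of_sigma)
  show "sigma_algebra UNIV (sets (borel :: real measure))"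
    using sets.sigma_algebra_axioms[of "borel :: real measure"] by simp
  show "positive (sets borel) (\<lambda>A. ennreal a * emeasure M A + ennreal b * emeasure N A)"
    by (simp add: positive_def)
  show "countably_additive (sets borel) (\<lambda>A. ennreal a * emeasure M A + ennreal b * emeasure N A)"
  proof (rule countably_additiveI)
    fix F :: "nat \<Rightarrow> real set"
    assume F: "range F \<subseteq> sets borel" "disjoint_family F"
    have "(\<Sum>i. emeasure M (F i)) = emeasure M (\<Union>i. F i)"
      "(\<Sum>i. emeasure N (F i)) = emeasure N (\<Union>i. F i)"
      using F M N by (auto intro!: suminf_emeasure)
    then show "(\<Sum>i. ennreal a * emeasure M (F i) + ennreal b * emeasure N (F i)) =
        ennreal a * emeasure M (\<Union>i. F i) + ennreal b * emeasure N (\<Union>i. F i)"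
      by (subst suminf_add[symmetric]) (auto simp: ennreal_suminf_cmult)
  qed
qed (use A in auto)

end

theory Submission
  imports Defs
begin

text \<open>
  Write \<open>\<nu> = n - k\<close>, \<open>c = \<surd>n \<eta>\<close> and \<open>z = \<theta>\<^sub>i / (\<sigma> \<xi> \<eta>)\<close>. Everything rests on two pivots: a standard
  normal \<open>G\<close> and, independent of it, a chi-square variable \<open>Q\<close> with \<open>\<nu>\<close> degrees of freedom, such
  that the scaled least squares error is \<open>U = G / c\<close> and \<open>sigma_hat / \<sigma> = \<surd>(Q / \<nu>)\<close>. In these terms the scaled
  error of the hard-thresholding estimator equals \<open>- z\<close> on the event \<open>\<bar>U + z\<bar> \<le> \<surd>(Q / \<nu>)\<close>, where the
  estimator vanishes, and equals \<open>U\<close> elsewhere. Since \<open>c \<rightarrow> \<infinity>\<close>, \<open>U\<close> tends to zero in probability, and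
  since \<open>z \<rightarrow> \<zeta>\<close>, the limit law can only charge \<open>- \<zeta>\<close> and \<open>0\<close>. Its weight at \<open>- \<zeta>\<close> is the limit of
  the probability \<open>zero_prob \<nu> c z\<close> of estimating zero (\<open>weak_conv_two_point\<close>). An infinite \<open>\<zeta>\<close> is
  harmless because that probability then tends to zero.

  The pivots come from linear algebra plus rotation invariance. An orthonormal basis of the
  orthogonal complement of the column space of \<open>X\<close> exhibits the residual sum of squares as a sum of
  \<open>\<nu>\<close> squared projections of the error vector, and the least squares error is a projection in one
  further orthogonal direction (\<open>least_squares_decomposition\<close>). Orthonormal projections of a
  Gaussian vector are independent and standard normal. This is derived from characteristic
  functions: if the joint characteristic function of finitely many variables is a product, the
  joint law is the product law (\<open>joint_law_eq_PiM_of_char\<close>). That statement is reduced to the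
  one-dimensional uniqueness theorem by exchanging one complex exponential after another for
  an indicator.

  The limit of \<open>zero_prob\<close> is found by conditioning on \<open>G = g\<close>. By independence,
  \<open>zero_prob \<nu> c z = \<integral> P(Q \<ge> \<nu> (g / c + z)\<^sup>2) dN(g)\<close>, and by dominated convergence the limit may be
  taken for each \<open>g\<close> separately. With fixed \<open>\<nu>\<close> this only uses that \<open>Q\<close> has no atoms. With
  \<open>\<nu> \<rightarrow> \<infinity>\<close>, the central limit theorem for \<open>Q\<close> turns the integrand into a normal tail probability
  at \<open>\<surd>(\<nu>/2) ((g / c + z)\<^sup>2 - 1)\<close>, evaluated along a sequence that converges in the extended reals.
  For \<open>\<bar>\<zeta>\<bar> \<noteq> 1\<close> this argument diverges. For \<open>\<zeta> = 1\<close> it is asymptotic to \<open>\<surd>2 (g - r) / \<kappa>\<close> with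
  \<open>\<kappa> = c / \<surd>\<nu>\<close> and \<open>r = c (1 - z)\<close>, so \<open>\<kappa> \<rightarrow> 0\<close> leaves the indicator of \<open>g < r\<close>, a positive
  finite limit of \<open>\<kappa>\<close> leaves a normal convolution, and \<open>\<kappa> \<rightarrow> \<infinity>\<close> removes \<open>g\<close>. The case \<open>\<zeta> = - 1\<close> follows from the
  symmetry of \<open>G\<close>.
\<close>

unbundle no inner_syntax

section \<open>Least squares and the orthogonal complement of the column space\<close>

text \<open>A nonzero kernel vector makes the columns linearly dependent; since the rank is computed from the
  set of columns, equal columns have to be excluded separately.\<close>

lemma full_column_rank_injective:
  fixes X :: "real mat"
  assumes X: "X \<in> carrier_mat n k" and rank: "vec_space.rank n X = k"
    and v: "v \<in> carrier_vec k" and Xv: "X *\<^sub>v v = 0\<^sub>v n"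
  shows "v = 0\<^sub>v k"
proof (rule ccontr)
  assume v0: "v \<noteq> 0\<^sub>v k"
  interpret vec_space "TYPE(real)" n .
  have "distinct (cols X)"
  proof (rule ccontr)
    assume nd: "\<not> distinct (cols X)"
    obtain S where S: "maximal S (\<lambda>T. T \<subseteq> set (cols X) \<and> lin_indpt T)"
      using maximal_exists[of "(\<lambda>T. T \<subseteq> set (cols X) \<and> lin_indpt T)" "card (set (cols X))" "{}"]
      by (meson List.finite_set card_mono empty_iff empty_subsetI finite_lin_indpt2 rev_finite_subset)
    have "rank X = card S" by (rule rank_card_indpt[OF X S])
    also have "\<dots> \<le> card (set (cols X))"
      using S by (simp add: card_mono maximal_def)
    also have "\<dots> < length (cols X)"
      using nd card_distinct card_length nat_less_le by metis
    finally show False using rank X by simp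
  qed
  with full_rank_lin_indpt[OF X rank] lin_depI[OF X v v0 Xv] show False by blast
qed

lemma scalar_prod_self_eq_0_iff:
  fixes v :: "real vec"
  assumes "v \<in> carrier_vec n"
  shows "v \<bullet> v = 0 \<longleftrightarrow> v = 0\<^sub>v n"
  using conjugate_square_eq_0_vec[OF assms] by simp

lemma scalar_prod_self_nonneg: "(v :: real vec) \<bullet> v \<ge> 0"
  using conjugate_square_ge_0_vec[of v] by simp

text \<open>The rows of \<open>B\<close> are found one at a time: as long as \<open>k + m < n\<close>, the square matrix whose rows are
  the columns of \<open>X\<close>, the vectors found so far and zero rows is singular, and any nonzero vector of
  its kernel can be normalised and added.\<close>

lemma orthonormal_complement:
  fixes X :: "real mat"
  assumes X: "X \<in> carrier_mat n k" and m: "k + m \<le> n"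
  shows "\<exists>B \<in> carrier_mat m n. B * transpose_mat B = 1\<^sub>m m \<and> B * X = 0\<^sub>m m k"
  using m
proof (induction m)
  case 0
  show ?case
    by (rule bexI[of _ "0\<^sub>m 0 n"]) (use X in \<open>auto intro!: eq_matI\<close>)
next
  case (Suc m)
  then obtain B where B: "B \<in> carrier_mat m n" and BB: "B * transpose_mat B = 1\<^sub>m m"
    and BX: "B * X = 0\<^sub>m m k" by auto
  define A where "A = mat n n (\<lambda>(r, c). if r < k then X $$ (c, r) else if r < k + m then B $$ (r - k, c) else 0)"
  have A: "A \<in> carrier_mat n n" unfolding A_def by simp
  \<comment> \<open>Row \<open>k + m\<close> of \<open>A\<close> is zero, so the transpose of \<open>A\<close> kills a unit vector.\<close>
  have "transpose_mat A *\<^sub>v unit_vec n (k + m) = 0\<^sub>v n"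
    using Suc.prems A
    by (intro eq_vecI) (auto simp: A_def scalar_prod_right_unit)
  moreover have "unit_vec n (k + m) \<noteq> (0\<^sub>v n :: real vec)"
    using Suc.prems by (metis Suc_le_lessD add_Suc_right index_unit_vec(1) index_zero_vec(1) zero_neq_one)
  ultimately have "Determinant.det (transpose_mat A) = 0"
    using A det_0_iff_vec_prod_zero_field[of "transpose_mat A" n] unit_vec_carrier[of n "k + m"]
    by (metis transpose_carrier_mat)
  then have "Determinant.det A = 0" using det_transpose[OF A] by simp
  then obtain v where v: "v \<in> carrier_vec n" "v \<noteq> 0\<^sub>v n" and Av: "A *\<^sub>v v = 0\<^sub>v n"
    using A det_0_iff_vec_prod_zero_field[OF A] by auto
  have Av': "row A r \<bullet> v = 0" if "r < n" for r
    using arg_cong[OF Av, of "\<lambda>x. x $ r"] that A by simp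
  have Xv: "col X r \<bullet> v = 0" if "r < k" for r
  proof -
    have "row A r = col X r"
      using that Suc.prems X by (intro eq_vecI) (auto simp: A_def)
    with Av'[of r] that Suc.prems show ?thesis by simp
  qed
  have Bv: "row B r \<bullet> v = 0" if "r < m" for r
  proof -
    have "row A (k + r) = row B r"
      using that Suc.prems B by (intro eq_vecI) (auto simp: A_def)
    with Av'[of "k + r"] that Suc.prems show ?thesis by simp
  qed
  have vv: "v \<bullet> v > 0"
    using scalar_prod_self_nonneg[of v] scalar_prod_self_eq_0_iff[OF v(1)] v(2) by linarith
  define w where "w = (1 / sqrt (v \<bullet> v)) \<cdot>\<^sub>v v"
  have w: "w \<in> carrier_vec n" unfolding w_def using v by simp
  have ww: "w \<bullet> w = 1" using vv v by (simp add: w_def)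
  have Xw: "w \<bullet> col X r = 0" if "r < k" for r
    using Xv[OF that] v X that comm_scalar_prod[of v n "col X r"] by (auto simp: w_def)
  have Bw: "row B r \<bullet> w = 0" if "r < m" for r
    using Bv[OF that] v B by (simp add: w_def)
  have wB: "w \<bullet> row B r = 0" if "r < m" for r
    using Bw[OF that] w B that comm_scalar_prod[of w n "row B r"] by auto
  define C where "C = mat (Suc m) n (\<lambda>(r, c). if r < m then B $$ (r, c) else w $ c)"
  have C: "C \<in> carrier_mat (Suc m) n" unfolding C_def by simp
  have rowC: "row C r = (if r < m then row B r else w)" if "r < Suc m" for r
    using that B w by (intro eq_vecI) (auto simp: C_def)
  have BB': "row B r \<bullet> row B s = (if r = s then 1 else 0)" if "r < m" "s < m" for r s
    using arg_cong[OF BB, of "\<lambda>M. M $$ (r, s)"] that B by simp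
  have BX': "row B r \<bullet> col X s = 0" if "r < m" "s < k" for r s
    using arg_cong[OF BX, of "\<lambda>M. M $$ (r, s)"] that B X by simp
  show ?case
  proof (rule bexI[OF _ C], intro conjI)
    show "C * transpose_mat C = 1\<^sub>m (Suc m)"
      using C by (intro eq_matI) (auto simp: rowC BB' Bw wB ww)
    show "C * X = 0\<^sub>m (Suc m) k"
      using C X by (intro eq_matI) (auto simp: rowC BX' Xw)
  qed
qed

lemma invertible_mat_inverse:
  fixes A :: "real mat"
  assumes A: "A \<in> carrier_mat n n" and inj: "\<And>v. v \<in> carrier_vec n \<Longrightarrow> A *\<^sub>v v = 0\<^sub>v n \<Longrightarrow> v = 0\<^sub>v n"
  shows "A * the (mat_inverse A) = 1\<^sub>m n" "the (mat_inverse A) * A = 1\<^sub>m n"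
    "the (mat_inverse A) \<in> carrier_mat n n"
proof -
  have "Determinant.det A \<noteq> 0"
    using det_0_iff_vec_prod_zero_field[OF A] inj by blast
  then have "A \<in> Units (ring_mat TYPE(real) n ())" by (rule det_non_zero_imp_unit[OF A])
  then obtain B where B: "mat_inverse A = Some B" using mat_inverse(1)[OF A, of "()"] by blast
  show "A * the (mat_inverse A) = 1\<^sub>m n" "the (mat_inverse A) * A = 1\<^sub>m n"
    "the (mat_inverse A) \<in> carrier_mat n n"
    using mat_inverse(2)[OF A B] B by auto
qed

lemma gram_matrix_injective:
  fixes X :: "real mat"
  assumes X: "X \<in> carrier_mat n k" and rank: "vec_space.rank n X = k"
    and v: "v \<in> carrier_vec k" and XXv: "(transpose_mat X * X) *\<^sub>v v = 0\<^sub>v k"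
  shows "v = 0\<^sub>v k"
proof -
  have Xv: "X *\<^sub>v v \<in> carrier_vec n" using X v by simp
  have "transpose_mat X *\<^sub>v (X *\<^sub>v v) = 0\<^sub>v k"
    using XXv X v by (simp add: assoc_mult_mat_vec[of "transpose_mat X" k n X k v])
  then have "(X *\<^sub>v v) \<bullet> (X *\<^sub>v v) = 0\<^sub>v k \<bullet> v"
    using transpose_vec_mult_scalar[OF X v Xv] by simp
  also have "\<dots> = 0" using v by simp
  finally have "X *\<^sub>v v = 0\<^sub>v n" using scalar_prod_self_eq_0_iff[OF Xv] by simp
  then show ?thesis using full_column_rank_injective[OF X rank v] by simp
qed

text \<open>The two projections, onto the column space of \<open>X\<close> and onto its orthogonal complement, add up to the
  identity. The hypotheses say that \<open>(L, B)\<close> stacked vertically is a left inverse of the square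
  matrix \<open>(X, B\<^sup>T)\<close>; it is therefore also a right inverse, which is the claim.\<close>

lemma hat_matrix_decomposition:
  fixes X L B :: "real mat"
  assumes X: "X \<in> carrier_mat n k" and L: "L \<in> carrier_mat k n" and B: "B \<in> carrier_mat \<nu> n"
    and n: "n = k + \<nu>"
    and LX: "L * X = 1\<^sub>m k" and BX: "B * X = 0\<^sub>m \<nu> k"
    and LB: "L * transpose_mat B = 0\<^sub>m k \<nu>" and BB: "B * transpose_mat B = 1\<^sub>m \<nu>"
  shows "X * L + transpose_mat B * B = 1\<^sub>m n"
proof -
  \<comment> \<open>The lower blocks have no rows, the right blocks of \<open>E\<close> no columns: this is horizontal and vertical stacking.\<close>
  define D where "D = four_block_mat X (transpose_mat B) (0\<^sub>m 0 k) (0\<^sub>m 0 \<nu>)"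
  define E where "E = four_block_mat L (0\<^sub>m k 0) B (0\<^sub>m \<nu> 0)"
  have D: "D \<in> carrier_mat n n" and E: "E \<in> carrier_mat n n"
    unfolding D_def E_def using X L B n by auto
  have "E * D = four_block_mat (L * X + 0\<^sub>m k 0 * 0\<^sub>m 0 k) (L * transpose_mat B + 0\<^sub>m k 0 * 0\<^sub>m 0 \<nu>)
      (B * X + 0\<^sub>m \<nu> 0 * 0\<^sub>m 0 k) (B * transpose_mat B + 0\<^sub>m \<nu> 0 * 0\<^sub>m 0 \<nu>)"
    unfolding D_def E_def
    by (rule mult_four_block_mat) (use X L B in auto)
  also have "\<dots> = four_block_mat (1\<^sub>m k) (0\<^sub>m k \<nu>) (0\<^sub>m \<nu> k) (1\<^sub>m \<nu>)"
    unfolding LX BX LB BB by simp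
  also have "\<dots> = 1\<^sub>m n" unfolding n by simp
  finally have "D * E = 1\<^sub>m n" using mat_mult_left_right_inverse[OF E D] by simp
  moreover have "D * E = four_block_mat (X * L + transpose_mat B * B) (X * 0\<^sub>m k 0 + transpose_mat B * 0\<^sub>m \<nu> 0)
      (0\<^sub>m 0 k * L + 0\<^sub>m 0 \<nu> * B) (0\<^sub>m 0 k * 0\<^sub>m k 0 + 0\<^sub>m 0 \<nu> * 0\<^sub>m \<nu> 0)"
    unfolding D_def E_def
    by (rule mult_four_block_mat) (use X L B in auto)
  ultimately have *: "four_block_mat (X * L + transpose_mat B * B) (X * 0\<^sub>m k 0 + transpose_mat B * 0\<^sub>m \<nu> 0)
      (0\<^sub>m 0 k * L + 0\<^sub>m 0 \<nu> * B) (0\<^sub>m 0 k * 0\<^sub>m k 0 + 0\<^sub>m 0 \<nu> * 0\<^sub>m \<nu> 0) = 1\<^sub>m n" by simp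
  have S: "X * L + transpose_mat B * B \<in> carrier_mat n n" using X L B by auto
  show ?thesis
  proof (rule eq_matI)
    fix a b assume ab: "a < dim_row (1\<^sub>m n :: real mat)" "b < dim_col (1\<^sub>m n :: real mat)"
    show "(X * L + transpose_mat B * B) $$ (a, b) = (1\<^sub>m n :: real mat) $$ (a, b)"
      using arg_cong[OF *, of "\<lambda>M. M $$ (a, b)"] ab carrier_matD[OF S]
      by (simp del: index_add_mat index_mult_mat)
  qed (use X L B in auto)
qed

text \<open>The errors enter the estimators only through \<open>n - k + 1\<close> mutually orthogonal directions: the
  orthonormal \<open>b j\<close> span the complement of the column space and produce the residual sum of squares,
  while \<open>w\<close>, a row of \<open>(X\<^sup>T X)\<inverse> X\<^sup>T\<close>, lies in the column space and produces the estimation error. The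
  squared length of \<open>w\<close> is a diagonal entry of \<open>(X\<^sup>T X)\<inverse>\<close>, whence its relation to \<open>\<xi>\<close>.\<close>

lemma least_squares_decomposition:
  fixes X :: "real mat"
  assumes X: "X \<in> carrier_mat n k" and rank: "vec_space.rank n X = k" and kn: "k \<le> n" and i: "i < k"
  obtains b w where
    "\<And>j. j < n - k \<Longrightarrow> b j \<in> carrier_vec n"
    "\<And>j l. j < n - k \<Longrightarrow> l < n - k \<Longrightarrow> b j \<bullet> b l = (if j = l then 1 else 0)"
    "w \<in> carrier_vec n" "w \<bullet> w > 0" "\<And>j. j < n - k \<Longrightarrow> w \<bullet> b j = 0"
    "xi X (Suc i) = sqrt (real n) * sqrt (w \<bullet> w)"
    "\<And>\<theta> u. \<theta> \<in> carrier_vec k \<Longrightarrow> u \<in> carrier_vec n \<Longrightarrow>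
       theta_LS X (X *\<^sub>v \<theta> + u) $ i = \<theta> $ i + w \<bullet> u"
    "\<And>\<theta> u. \<theta> \<in> carrier_vec k \<Longrightarrow> u \<in> carrier_vec n \<Longrightarrow>
       (X *\<^sub>v \<theta> + u - X *\<^sub>v theta_LS X (X *\<^sub>v \<theta> + u)) \<bullet> (X *\<^sub>v \<theta> + u - X *\<^sub>v theta_LS X (X *\<^sub>v \<theta> + u))
         = (\<Sum>j<n - k. (b j \<bullet> u)\<^sup>2)"
proof -
  define G where "G = transpose_mat X * X"
  have G: "G \<in> carrier_mat k k" unfolding G_def using X by simp
  define K where "K = the (mat_inverse G)"
  have GK: "G * K = 1\<^sub>m k" and KG: "K * G = 1\<^sub>m k" and K: "K \<in> carrier_mat k k"
    unfolding K_def using invertible_mat_inverse[OF G] gram_matrix_injective[OF X rank] unfolding G_def by auto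
  have Gt: "transpose_mat G = G"
    unfolding G_def using X by (subst transpose_mult[of _ k n _ k]) auto
  have Kt: "transpose_mat K = K"
  proof -
    have "transpose_mat K * G = transpose_mat (G * K)"
      using transpose_mult[OF G K] Gt by simp
    also have "\<dots> = 1\<^sub>m k" unfolding GK by simp
    finally have "transpose_mat K * G = 1\<^sub>m k" .
    then have "transpose_mat K * (G * K) = K"
      using assoc_mult_mat[of "transpose_mat K" k k G k K k] G K by simp
    then show ?thesis using GK K by simp
  qed
  define L where "L = K * transpose_mat X"
  have L: "L \<in> carrier_mat k n" unfolding L_def using K X by simp
  have LX: "L * X = 1\<^sub>m k"
    unfolding L_def using assoc_mult_mat[of K k k "transpose_mat X" n X k] K X KG by (simp add: G_def)
  have LLt: "L * transpose_mat L = K"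
  proof -
    have "transpose_mat L = X * K"
      unfolding L_def using transpose_mult[of K k k "transpose_mat X" n] K X Kt by simp
    then have "L * transpose_mat L = (L * X) * K"
      using assoc_mult_mat[of L k n X k K k] L X K by simp
    also have "\<dots> = K" unfolding LX using K by simp
    finally show ?thesis .
  qed
  obtain B where B: "B \<in> carrier_mat (n - k) n" and BB: "B * transpose_mat B = 1\<^sub>m (n - k)"
    and BX: "B * X = 0\<^sub>m (n - k) k"
    using orthonormal_complement[OF X, of "n - k"] kn by auto
  have XtBt: "transpose_mat X * transpose_mat B = 0\<^sub>m k (n - k)"
    using transpose_mult[OF B X] unfolding BX by (metis transpose_carrier_mat zero_transpose_mat)
  have LB: "L * transpose_mat B = 0\<^sub>m k (n - k)"
    unfolding L_def using assoc_mult_mat[of K k k "transpose_mat X" n "transpose_mat B" "n - k"] K X B XtBt by simp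
  have dec: "X * L + transpose_mat B * B = 1\<^sub>m n"
    by (rule hat_matrix_decomposition[OF X L B _ LX BX LB BB]) (use kn in simp)
  define w where "w = row L i"
  have w: "w \<in> carrier_vec n" unfolding w_def using L i by simp
  have ww: "w \<bullet> w = K $$ (i, i)"
    using arg_cong[OF LLt, of "\<lambda>M. M $$ (i, i)"] L i by (simp add: w_def)
  have w0: "w \<noteq> 0\<^sub>v n"
  proof
    assume "w = 0\<^sub>v n"
    moreover have "w \<bullet> col X i = 1"
      using arg_cong[OF LX, of "\<lambda>M. M $$ (i, i)"] L X i by (simp add: w_def)
    ultimately show False using X i by simp
  qed
  show thesis
  proof (rule that[of "row B" w])
    show "row B j \<in> carrier_vec n" if "j < n - k" for j using B that by simp
    show "row B j \<bullet> row B l = (if j = l then 1 else 0)" if "j < n - k" "l < n - k" for j l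
      using arg_cong[OF BB, of "\<lambda>M. M $$ (j, l)"] that B by simp
    show "w \<in> carrier_vec n" by (rule w)
    show "w \<bullet> w > 0"
      using scalar_prod_self_nonneg[of w] scalar_prod_self_eq_0_iff[OF w] w0 by linarith
    show "w \<bullet> row B j = 0" if "j < n - k" for j
      using arg_cong[OF LB, of "\<lambda>M. M $$ (i, j)"] that L B i by (simp add: w_def)
    show "xi X (Suc i) = sqrt (real n) * sqrt (w \<bullet> w)"
    proof (cases "n = 0")
      case True with i kn show ?thesis by simp
    next
      case False
      define G' where "G' = (1 / real n) \<cdot>\<^sub>m G"
      define K' where "K' = real n \<cdot>\<^sub>m K"
      have G': "G' \<in> carrier_mat k k" and K': "K' \<in> carrier_mat k k" unfolding G'_def K'_def using G K by auto
      have KG': "K' * G' = 1\<^sub>m k"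
        unfolding K'_def G'_def using False K G KG 

        by (simp add: mult_smult_distrib[of _ k k _ k] mult_smult_assoc_mat[of K k k G k])
          (auto intro!: eq_matI)
      have inj: "v = 0\<^sub>v k" if "v \<in> carrier_vec k" "G' *\<^sub>v v = 0\<^sub>v k" for v
      proof -
        have "v = (K' * G') *\<^sub>v v" using that KG' by simp
        also have "\<dots> = K' *\<^sub>v (G' *\<^sub>v v)" using that K' G' by simp
        also have "\<dots> = 0\<^sub>v k" using that K' by (auto intro!: eq_vecI)
        finally show ?thesis .
      qed
      note inv = invertible_mat_inverse[OF G' inj]
      have "the (mat_inverse G') = (K' * G') * the (mat_inverse G')" using KG' inv(3) by simp
      also have "\<dots> = K' * (G' * the (mat_inverse G'))" using K' G' inv(3) by (rule assoc_mult_mat)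
      also have "\<dots> = K'" using inv(1) K' by simp
      finally have "the (mat_inverse G') $$ (i, i) = real n * (w \<bullet> w)"
        unfolding ww K'_def using K i by simp
      then show ?thesis
        using X unfolding xi_def G'_def G_def by (simp add: real_sqrt_mult)
    qed
    fix \<theta> u :: "real vec" assume \<theta>: "\<theta> \<in> carrier_vec k" and u: "u \<in> carrier_vec n"
    have X\<theta>: "X *\<^sub>v \<theta> \<in> carrier_vec n" using X \<theta> by simp
    have LS: "theta_LS X (X *\<^sub>v \<theta> + u) = \<theta> + L *\<^sub>v u"
    proof -
      have "theta_LS X (X *\<^sub>v \<theta> + u) = L *\<^sub>v (X *\<^sub>v \<theta> + u)"
        unfolding theta_LS_def L_def K_def[symmetric] G_def[symmetric]
        using assoc_mult_mat_vec[of K k k "transpose_mat X" n "X *\<^sub>v \<theta> + u"] K X \<theta> u by simp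
      also have "\<dots> = L *\<^sub>v (X *\<^sub>v \<theta>) + L *\<^sub>v u"
        by (rule mult_add_distrib_mat_vec[OF L X\<theta> u])
      also have "L *\<^sub>v (X *\<^sub>v \<theta>) = (L * X) *\<^sub>v \<theta>" using L X \<theta> by simp
      also have "\<dots> = \<theta>" unfolding LX using \<theta> by simp
      finally show ?thesis .
    qed
    show "theta_LS X (X *\<^sub>v \<theta> + u) $ i = \<theta> $ i + w \<bullet> u"
      unfolding LS using L i \<theta> by (simp add: w_def)
    have Bu: "B *\<^sub>v u \<in> carrier_vec (n - k)" using B u by simp
    have BtBu: "transpose_mat B *\<^sub>v (B *\<^sub>v u) \<in> carrier_vec n" using B u by simp
    have XLu: "X *\<^sub>v (L *\<^sub>v u) \<in> carrier_vec n" using X L u by simp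
    have "u = (X * L + transpose_mat B * B) *\<^sub>v u" unfolding dec using u by simp
    also have "\<dots> = X *\<^sub>v (L *\<^sub>v u) + transpose_mat B *\<^sub>v (B *\<^sub>v u)"
      using X L B u by (subst add_mult_distrib_mat_vec[of _ n n]) auto
    finally have u_dec: "u = X *\<^sub>v (L *\<^sub>v u) + transpose_mat B *\<^sub>v (B *\<^sub>v u)" .
    have cancel: "a + e - (a + b) = c"
      if "a \<in> carrier_vec n" "b \<in> carrier_vec n" "c \<in> carrier_vec n" "e = b + c" for a b c e :: "real vec"
      using that by (intro eq_vecI) auto
    have "X *\<^sub>v (\<theta> + L *\<^sub>v u) = X *\<^sub>v \<theta> + X *\<^sub>v (L *\<^sub>v u)"
      by (rule mult_add_distrib_mat_vec[OF X \<theta>]) (use L u in simp)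
    then have res: "X *\<^sub>v \<theta> + u - X *\<^sub>v theta_LS X (X *\<^sub>v \<theta> + u) = transpose_mat B *\<^sub>v (B *\<^sub>v u)"
      unfolding LS using cancel[OF X\<theta> XLu BtBu u_dec] by simp
    have "(transpose_mat B *\<^sub>v (B *\<^sub>v u)) \<bullet> (transpose_mat B *\<^sub>v (B *\<^sub>v u))
        = (B *\<^sub>v u) \<bullet> (B *\<^sub>v (transpose_mat B *\<^sub>v (B *\<^sub>v u)))"
      by (rule transpose_vec_mult_scalar[OF B BtBu Bu])
    also have "B *\<^sub>v (transpose_mat B *\<^sub>v (B *\<^sub>v u)) = B *\<^sub>v u"
      using assoc_mult_mat_vec[of B "n - k" n "transpose_mat B" "n - k" "B *\<^sub>v u"] B Bu BB by simp
    also have "(B *\<^sub>v u) \<bullet> (B *\<^sub>v u) = (\<Sum>j<n - k. (row B j \<bullet> u)\<^sup>2)"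
      using B by (simp add: scalar_prod_def power2_eq_square lessThan_atLeast0)
    finally show "(X *\<^sub>v \<theta> + u - X *\<^sub>v theta_LS X (X *\<^sub>v \<theta> + u)) \<bullet> (X *\<^sub>v \<theta> + u - X *\<^sub>v theta_LS X (X *\<^sub>v \<theta> + u))
         = (\<Sum>j<n - k. (row B j \<bullet> u)\<^sup>2)"
      unfolding res .
  qed
qed

section \<open>Joint laws from characteristic functions, and Gaussian projections\<close>

text \<open>Uniqueness of characteristic functions under a change of measure: normalising the weight \<open>g\<close> to a
  density, the hypothesis says that \<open>Z\<close> has characteristic function \<open>char L\<close> under the reweighted
  probability, hence law \<open>L\<close>.\<close>

lemma (in prob_space) weighted_law_unique_nonneg:
  fixes g Z :: "'a \<Rightarrow> real"
  assumes g [measurable]: "g \<in> borel_measurable M" and bd: "\<And>x. x \<in> space M \<Longrightarrow> 0 \<le> g x \<and> g x \<le> C"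
    and Z [measurable]: "Z \<in> borel_measurable M" and L: "real_distribution L"
    and fac: "\<And>t. (CLINT x|M. of_real (g x) * iexp (t * Z x)) = of_real (LINT x|M. g x) * char L t"
    and A [measurable]: "A \<in> sets borel"
  shows "(LINT x|M. g x * indicator A (Z x)) = (LINT x|M. g x) * measure L A"
proof -
  define c where "c = (LINT x|M. g x)"
  have int: "integrable M g"
    by (rule integrable_const_bound[where B = C]) (use bd in auto)
  have c: "c \<ge> 0" unfolding c_def by (rule Bochner_Integration.integral_nonneg) (use bd in auto)
  show ?thesis
  proof (cases "c = 0")
    case True
    then have "AE x in M. g x = 0"
      using integral_nonneg_eq_0_iff_AE[OF int] bd unfolding c_def by auto
    then have "(LINT x|M. g x * indicator A (Z x)) = (LINT x|M. 0)"
      by (intro integral_cong_AE) auto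
    then show ?thesis using True unfolding c_def by simp
  next
    case False
    with c have c: "c > 0" by simp
    define D where "D = density M (\<lambda>x. ennreal (g x / c))"
    have "emeasure D (space D) = (\<integral>\<^sup>+x. ennreal (g x / c) \<partial>M)"
      unfolding D_def by (simp add: emeasure_density cong: nn_integral_cong)
    also have "\<dots> = ennreal (LINT x|M. g x / c)"
      by (rule nn_integral_eq_integral) (use int bd c in auto)
    also have "\<dots> = 1" using c by (simp add: c_def)
    finally interpret D: prob_space D by (rule prob_spaceI)
    have ZD [measurable]: "Z \<in> borel_measurable D" unfolding D_def by simp
    define N where "N = distr D borel Z"
    interpret N: real_distribution N unfolding N_def using D.real_distribution_distr ZD by simp
    have "char N t = char L t" for t
    proof -
      have "char N t = (CLINT x|D. iexp (t * Z x))"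
        unfolding N_def char_def by (simp add: integral_distr)
      also have "\<dots> = (CLINT x|M. (g x / c) *\<^sub>R iexp (t * Z x))"
        unfolding D_def by (rule integral_density) (use bd c in auto)
      also have "\<dots> = (CLINT x|M. (of_real (g x) * iexp (t * Z x)) / of_real c)"
        by (simp add: scaleR_conv_of_real)
      also have "\<dots> = char L t" using fac[of t] c by (simp add: c_def)
      finally show ?thesis .
    qed
    then have "N = L"
      by (intro Levy_uniqueness N.real_distribution_axioms L) auto
    then have "measure L A = (LINT x|N. indicator A x)" using N.space_eq_univ by simp
    also have "\<dots> = (LINT x|D. indicator A (Z x))"
      unfolding N_def by (rule integral_distr) auto
    also have "\<dots> = (LINT x|M. (g x / c) *\<^sub>R indicator A (Z x))"
      unfolding D_def by (rule integral_density) (use bd c in auto)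
    also have "\<dots> = (LINT x|M. g x * indicator A (Z x)) / c" by simp
    finally show ?thesis using c unfolding c_def[symmetric] by simp
  qed
qed

text \<open>Bounded signed weights are reduced to nonnegative ones by adding the constant weight 1, to which the
  hypothesis on \<open>Z\<close> itself applies. The family \<open>e\<close> names the exponentials, so that they are kept as
  units in calculations.\<close>

lemma (in prob_space) weighted_law_unique_real:
  fixes h Z :: "'a \<Rightarrow> real" and e :: "real \<Rightarrow> 'a \<Rightarrow> complex"
  assumes h [measurable]: "h \<in> borel_measurable M" and bd: "\<And>x. x \<in> space M \<Longrightarrow> \<bar>h x\<bar> \<le> 1"
    and Z [measurable]: "Z \<in> borel_measurable M" and L: "real_distribution L"
    and e_def: "\<And>t x. e t x = iexp (t * Z x)"
    and charZ: "\<And>t. (CLINT x|M. e t x) = char L t"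
    and fac: "\<And>t. (CLINT x|M. of_real (h x) * e t x) = of_real (LINT x|M. h x) * char L t"
    and A [measurable]: "A \<in> sets borel"
  shows "(LINT x|M. h x * indicator A (Z x)) = (LINT x|M. h x) * measure L A"
proof -
  have e [measurable]: "e t \<in> borel_measurable M" for t unfolding e_def[abs_def] by measurable
  have ne [simp]: "cmod (e t x) = 1" for t x unfolding e_def by simp
  have int_h: "integrable M h"
    by (rule integrable_const_bound[where B = 1]) (use bd in auto)
  have int_e: "integrable M (e t)" for t
    by (rule integrable_const_bound[where B = 1]) auto
  have int_he: "integrable M (\<lambda>x. of_real (h x) * e t x)" for t
    by (rule integrable_const_bound[where B = 1]) (use bd in \<open>auto simp: norm_mult\<close>)
  have int_i: "integrable M (\<lambda>x. indicator A (Z x) :: real)"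
    by (rule integrable_const_bound[where B = 1]) (auto simp: indicator_def)
  have int_hi: "integrable M (\<lambda>x. h x * indicator A (Z x))"
    by (rule integrable_const_bound[where B = 1]) (use bd in \<open>auto simp: indicator_def\<close>)
  have "(LINT x|M. (1 + h x) * indicator A (Z x)) = (LINT x|M. 1 + h x) * measure L A"
  proof (rule weighted_law_unique_nonneg[where C = 2, OF _ _ Z L _ A])
    show "0 \<le> 1 + h x \<and> 1 + h x \<le> 2" if "x \<in> space M" for x
      using bd[OF that] by linarith
    show "(CLINT x|M. of_real (1 + h x) * iexp (t * Z x)) = of_real (LINT x|M. 1 + h x) * char L t" for t
      unfolding e_def[symmetric]
      using int_h int_e int_he by (simp add: distrib_right charZ fac prob_space)
  qed simp
  moreover have "(LINT x|M. 1 * indicator A (Z x)) = (LINT x|M. 1) * measure L A"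
  proof (rule weighted_law_unique_nonneg[where C = 1, OF _ _ Z L _ A])
    show "(CLINT x|M. of_real 1 * iexp (t * Z x)) = of_real (LINT x|M. 1) * char L t" for t
      unfolding e_def[symmetric] using charZ by (simp add: prob_space)
  qed auto
  ultimately show ?thesis
    using int_h int_i int_hi by (simp add: distrib_right prob_space)
qed

text \<open>Complex weights are split into real and imaginary parts. The factorisation hypothesis for \<open>f\<close> at
  \<open>- t\<close> is, after conjugation, the one for the conjugate of \<open>f\<close> at \<open>t\<close>, so it passes to both parts.\<close>

lemma (in prob_space) weighted_law_unique:
  fixes f :: "'a \<Rightarrow> complex" and Z :: "'a \<Rightarrow> real"
  assumes f [measurable]: "f \<in> borel_measurable M" and bd: "\<And>x. x \<in> space M \<Longrightarrow> cmod (f x) \<le> 1"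
    and Z [measurable]: "Z \<in> borel_measurable M" and L: "real_distribution L"
    and charZ: "\<And>t. (CLINT x|M. iexp (t * Z x)) = char L t"
    and fac: "\<And>t. (CLINT x|M. f x * iexp (t * Z x)) = (CLINT x|M. f x) * char L t"
    and A [measurable]: "A \<in> sets borel"
  shows "(CLINT x|M. f x * of_real (indicator A (Z x))) = (CLINT x|M. f x) * of_real (measure L A)"
proof -
  define e where "e t x = iexp (t * Z x)" for t x
  have e [measurable]: "e t \<in> borel_measurable M" for t unfolding e_def[abs_def] by measurable
  have ne [simp]: "cmod (e t x) = 1" for t x unfolding e_def by simp
  have e_cnj: "cnj (e t x) = e (- t) x" for t x unfolding e_def by (simp add: exp_cnj)
  have charZ': "(CLINT x|M. e t x) = char L t" for t unfolding e_def by (rule charZ)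
  have fac1: "(CLINT x|M. f x * e t x) = (CLINT x|M. f x) * char L t" for t unfolding e_def by (rule fac)
  have f' [measurable]: "(\<lambda>x. cnj (f x)) \<in> borel_measurable M"
    by (rule borel_measurable_continuous_on[OF _ f]) (rule continuous_on_cnj[OF continuous_on_id])
  have int_f: "integrable M f"
    by (rule integrable_const_bound[where B = 1]) (use bd in auto)
  have int_fe: "integrable M (\<lambda>x. f x * e t x)" for t
    by (rule integrable_const_bound[where B = 1]) (use bd in \<open>auto simp: norm_mult\<close>)
  have int_ce: "integrable M (\<lambda>x. cnj (f x) * e t x)" for t
    by (rule integrable_const_bound[where B = 1]) (use bd in \<open>auto simp: norm_mult\<close>)
  have int_fi: "integrable M (\<lambda>x. f x * of_real (indicator A (Z x)))"
    by (rule integrable_const_bound[where B = 1]) (use bd in \<open>auto simp: norm_mult indicator_def\<close>)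
  have char_cnj: "cnj (char L (- t)) = char L t" for t
    unfolding charZ'[symmetric] by (subst Bochner_Integration.integral_cnj[symmetric]) (simp add: e_cnj)
  have fac2: "(CLINT x|M. cnj (f x) * e t x) = cnj (CLINT x|M. f x) * char L t" for t
  proof -
    have "(CLINT x|M. cnj (f x) * e t x) = cnj (CLINT x|M. f x * e (- t) x)"
      by (subst Bochner_Integration.integral_cnj[symmetric]) (simp add: e_cnj)
    also have "\<dots> = cnj (CLINT x|M. f x) * char L t"
      unfolding fac1 using char_cnj[of t] by simp
    finally show ?thesis .
  qed
  have Re_eq: "of_real (Re z) = (z + cnj z) / 2" and Im_eq: "of_real (Im z) = (z - cnj z) / (2 * \<i>)" for z
    by (auto simp: complex_eq_iff)
  have Re: "(LINT x|M. Re (f x) * indicator A (Z x)) = (LINT x|M. Re (f x)) * measure L A"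
  proof (rule weighted_law_unique_real[OF _ _ Z L e_def charZ' _ A])
    show "\<bar>Re (f x)\<bar> \<le> 1" if "x \<in> space M" for x
      using bd[OF that] abs_Re_le_cmod[of "f x"] by linarith
    fix t
    have "(CLINT x|M. of_real (Re (f x)) * e t x) = (CLINT x|M. (f x * e t x + cnj (f x) * e t x) / 2)"
      unfolding Re_eq by (simp add: distrib_right)
    also have "\<dots> = ((CLINT x|M. f x * e t x) + (CLINT x|M. cnj (f x) * e t x)) / 2"
      using int_fe int_ce by simp
    also have "\<dots> = of_real (Re (CLINT x|M. f x)) * char L t"
      unfolding fac1 fac2 Re_eq by (simp add: distrib_right)
    finally show "(CLINT x|M. of_real (Re (f x)) * e t x) = of_real (LINT x|M. Re (f x)) * char L t"
      using int_f by (simp add: integral_Re)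
  qed simp
  have Im: "(LINT x|M. Im (f x) * indicator A (Z x)) = (LINT x|M. Im (f x)) * measure L A"
  proof (rule weighted_law_unique_real[OF _ _ Z L e_def charZ' _ A])
    show "\<bar>Im (f x)\<bar> \<le> 1" if "x \<in> space M" for x
      using bd[OF that] abs_Im_le_cmod[of "f x"] by linarith
    fix t
    have "(CLINT x|M. of_real (Im (f x)) * e t x)
        = (CLINT x|M. (f x * e t x - cnj (f x) * e t x) / (2 * \<i>))"
      unfolding Im_eq by (simp only: left_diff_distrib times_divide_eq_left)
    also have "\<dots> = ((CLINT x|M. f x * e t x) - (CLINT x|M. cnj (f x) * e t x)) / (2 * \<i>)"
      using int_fe int_ce by (simp only: integral_divide_zero Bochner_Integration.integral_diff)
    also have "\<dots> = of_real (Im (CLINT x|M. f x)) * char L t"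
      unfolding fac1 fac2 Im_eq by (simp only: left_diff_distrib times_divide_eq_left)
    finally show "(CLINT x|M. of_real (Im (f x)) * e t x) = of_real (LINT x|M. Im (f x)) * char L t"
      using int_f by (simp add: integral_Im)
  qed simp
  show ?thesis
    using Re Im int_f int_fi
    by (intro complex_eqI) (simp_all flip: integral_Re integral_Im)
qed

text \<open>Intermediate stage between the factorisation of the joint characteristic function (\<open>J\<close> empty) and
  independence (\<open>J = I\<close>). To move an index \<open>j\<close> into \<open>J\<close>, all other factors are used as a complex
  weight in \<open>weighted_law_unique\<close>.\<close>

lemma (in prob_space) char_factorises_indicators:
  fixes Z :: "'i \<Rightarrow> 'a \<Rightarrow> real"
  assumes I: "finite I" and Z [measurable]: "\<And>i. i \<in> I \<Longrightarrow> Z i \<in> borel_measurable M"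
    and L: "\<And>i. i \<in> I \<Longrightarrow> real_distribution (L i)"
    and fac: "\<And>s. (CLINT x|M. (\<Prod>i\<in>I. iexp (s i * Z i x))) = (\<Prod>i\<in>I. char (L i) (s i))"
    and A: "\<And>i. i \<in> I \<Longrightarrow> A i \<in> sets borel" and J: "J \<subseteq> I"
  shows "(CLINT x|M. (\<Prod>i\<in>I. if i \<in> J then of_real (indicator (A i) (Z i x)) else iexp (s i * Z i x)))
    = (\<Prod>i\<in>I. if i \<in> J then of_real (measure (L i) (A i)) else char (L i) (s i))"
  using finite_subset[OF J I] J
proof (induction J arbitrary: s rule: finite_induct)
  case empty
  show ?case using fac by simp
next
  case (insert j J)
  then have j: "j \<in> I" "j \<notin> J" and J: "J \<subseteq> I" by auto
  define F where "F i x = (if i \<in> J then of_real (indicator (A i) (Z i x)) else iexp (s i * Z i x))" for i x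
  define \<psi> where "\<psi> i = (if i \<in> J then of_real (measure (L i) (A i)) else char (L i) (s i))" for i
  define f where "f x = (\<Prod>i\<in>I - {j}. F i x)" for x
  define c where "c = (\<Prod>i\<in>I - {j}. \<psi> i)"
  have A' [measurable]: "A i \<in> sets borel" if "i \<in> I" for i using A that by auto
  have f [measurable]: "f \<in> borel_measurable M"
    unfolding f_def F_def by (intro borel_measurable_prod) (auto intro!: measurable_If)
  have bd: "cmod (f x) \<le> 1" for x
    unfolding f_def prod_norm[symmetric] by (rule prod_le_1) (auto simp: F_def indicator_def)
  have split_off: "(\<Prod>i\<in>I. if i \<in> J then a i else b i) = (\<Prod>i\<in>I - {j}. if i \<in> J then a i else b i) * b j"
    and split_in: "(\<Prod>i\<in>I. if i \<in> insert j J then a i else b i) = (\<Prod>i\<in>I - {j}. if i \<in> J then a i else b i) * a j"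
    for a b :: "'i \<Rightarrow> complex"
    using j I by (auto simp: prod.remove[of I j] mult.commute intro!: prod.cong arg_cong2[where f = "(*)"])
  have upd: "(\<Prod>i\<in>I - {j}. if i \<in> J then a i else g i ((s(j := t)) i)) = (\<Prod>i\<in>I - {j}. if i \<in> J then a i else g i (s i))"
    for a :: "'i \<Rightarrow> complex" and g t
    by (rule prod.cong) auto
  have key: "(CLINT x|M. f x * iexp (t * Z j x)) = c * char (L j) t" for t
    using insert.IH[OF J, of "s(j := t)"]
    unfolding split_off upd[of _ "\<lambda>i s. iexp (s * Z i x)" for x] upd[of _ "\<lambda>i. char (L i)"]
    unfolding f_def F_def c_def \<psi>_def by simp
  interpret Lj: real_distribution "L j" using L j by simp
  have c: "(CLINT x|M. f x) = c" using key[of 0] Lj.char_zero by simp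
  have charZ: "(CLINT x|M. iexp (t * Z j x)) = char (L j) t" for t
  proof -
    have one: "char (L i) 0 = 1" if "i \<in> I" for i
      using real_distribution.char_zero[OF L[OF that]] .
    show ?thesis
      using fac[of "(\<lambda>_. 0)(j := t)"] j I one by (simp add: prod.remove[of I j])
  qed
  have "(CLINT x|M. f x * of_real (indicator (A j) (Z j x))) = c * of_real (measure (L j) (A j))"
    using weighted_law_unique[OF f bd Z[OF j(1)] Lj.real_distribution_axioms charZ _ A[OF j(1)]] key c by simp
  then show ?case
    unfolding split_in f_def F_def c_def \<psi>_def .
qed

text \<open>A version of Kac's theorem, stated for the joint law because this is the form in which the chi-square
  distribution is defined.\<close>

theorem (in prob_space) joint_law_eq_PiM_of_char:
  fixes Z :: "'i \<Rightarrow> 'a \<Rightarrow> real" and L :: "'i \<Rightarrow> real measure"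
  assumes I: "finite I" and Z [measurable]: "\<And>i. i \<in> I \<Longrightarrow> Z i \<in> borel_measurable M"
    and L: "\<And>i. real_distribution (L i)"
    and fac: "\<And>s. (CLINT x|M. (\<Prod>i\<in>I. iexp (s i * Z i x))) = (\<Prod>i\<in>I. char (L i) (s i))"
  shows "distr M (PiM I (\<lambda>_. borel)) (\<lambda>x. \<lambda>i\<in>I. Z i x) = PiM I L"
proof -
  interpret L: real_distribution "L i" for i by (rule L)
  interpret product_sigma_finite L by standard
  have [measurable]: "(\<lambda>x. \<lambda>i\<in>I. Z i x) \<in> measurable M (PiM I (\<lambda>_. borel))"
    by (rule measurable_restrict) (rule Z)
  show ?thesis
  proof (rule PiM_eqI[OF I])
    show "sets (distr M (PiM I (\<lambda>_. borel)) (\<lambda>x. \<lambda>i\<in>I. Z i x)) = sets (PiM I L)"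
      unfolding sets_distr by (rule sets_PiM_cong) auto
    fix A assume A: "\<And>i. i \<in> I \<Longrightarrow> A i \<in> sets (L i)"
    then have A' [measurable]: "\<And>i. i \<in> I \<Longrightarrow> A i \<in> sets borel" by auto
    define E where "E = {x \<in> space M. \<forall>i\<in>I. Z i x \<in> A i}"
    have E [measurable]: "E \<in> sets M" unfolding E_def using I by measurable
    have "complex_of_real (prob E) = (CLINT x|M. of_real (indicator E x))"
      by (simp add: Int_absorb2 sets.sets_into_space[OF E])
    also have "\<dots> = (CLINT x|M. (\<Prod>i\<in>I. of_real (indicator (A i) (Z i x))))"
    proof (rule Bochner_Integration.integral_cong)
      fix x assume x: "x \<in> space M"
      have "(\<Prod>i\<in>I. indicator (A i) (Z i x)) = (indicator E x :: real)"
      proof (cases "x \<in> E")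
        case True then show ?thesis by (auto simp: E_def intro!: prod.neutral)
      next
        case False
        with x obtain i where "i \<in> I" "Z i x \<notin> A i" by (auto simp: E_def)
        with False I show ?thesis by (auto intro!: prod_zero bexI[of _ i])
      qed
      then show "complex_of_real (indicator E x) = (\<Prod>i\<in>I. of_real (indicator (A i) (Z i x)))"
        by (simp flip: of_real_prod)
    qed simp
    also have "\<dots> = (\<Prod>i\<in>I. of_real (measure (L i) (A i)))"
      using char_factorises_indicators[OF I Z L fac A' subset_refl] by simp
    finally have "prob E = (\<Prod>i\<in>I. measure (L i) (A i))"
      by (simp flip: of_real_prod)
    moreover have "(\<lambda>x. \<lambda>i\<in>I. Z i x) -` (Pi\<^sub>E I A) \<inter> space M = E"
      by (auto simp: E_def)
    ultimately show "emeasure (distr M (PiM I (\<lambda>_. borel)) (\<lambda>x. \<lambda>i\<in>I. Z i x)) (Pi\<^sub>E I A)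
        = (\<Prod>i\<in>I. emeasure (L i) (A i))"
      using I A' by (subst emeasure_distr)
        (auto simp: emeasure_eq_measure L.emeasure_eq_measure prod_ennreal intro!: sets_PiM_I_finite)
  qed
qed

lemma gaussian_errors_scalar_prod_measurable:
  assumes u: "gaussian_errors M n \<sigma> u"
  shows "(\<lambda>\<omega>. v \<bullet> u \<omega>) \<in> borel_measurable M"
proof -
  have [measurable]: "(\<lambda>\<omega>. u \<omega> $ j) \<in> borel_measurable M" if "j < n" for j
    using u that distributed_measurable[of M lborel "\<lambda>\<omega>. u \<omega> $ j"] unfolding gaussian_errors_def by auto
  have "(\<lambda>\<omega>. \<Sum>j<n. v $ j * u \<omega> $ j) \<in> borel_measurable M" by measurable
  moreover have "v \<bullet> u \<omega> = (\<Sum>j<n. v $ j * u \<omega> $ j)" if "\<omega> \<in> space M" for \<omega>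
    using u that unfolding gaussian_errors_def by (auto simp: scalar_prod_def lessThan_atLeast0)
  ultimately show ?thesis by (simp cong: measurable_cong)
qed

text \<open>A linear combination of the projections with coefficients \<open>s i\<close> is a linear combination of the
  independent errors with coefficients \<open>c j\<close>, and orthonormality makes both coefficient vectors
  equally long. So the joint characteristic function is \<open>exp (- \<Sum> (s i)\<^sup>2 / 2)\<close>, a product.\<close>

theorem (in prob_space) orthonormal_gaussian_projections:
  fixes u :: "'a \<Rightarrow> real vec" and q :: "'i \<Rightarrow> real vec"
  assumes u: "gaussian_errors M n \<sigma> u" and \<sigma>: "0 < \<sigma>" and I: "finite I"
    and q: "\<And>i. i \<in> I \<Longrightarrow> q i \<in> carrier_vec n"
    and orth: "\<And>i j. i \<in> I \<Longrightarrow> j \<in> I \<Longrightarrow> q i \<bullet> q j = (if i = j then 1 else 0)"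
  shows "distr M (PiM I (\<lambda>_. borel)) (\<lambda>\<omega>. \<lambda>i\<in>I. (q i \<bullet> u \<omega>) / \<sigma>) = PiM I (\<lambda>_. std_normal_distribution)"
proof (rule joint_law_eq_PiM_of_char[OF I])
  have carr: "\<And>\<omega>. \<omega> \<in> space M \<Longrightarrow> u \<omega> \<in> carrier_vec n"
    and indep: "indep_vars (\<lambda>_. borel) (\<lambda>j \<omega>. u \<omega> $ j) {..<n}"
    and normal: "\<And>j. j < n \<Longrightarrow> distributed M lborel (\<lambda>\<omega>. u \<omega> $ j) (\<lambda>x. ennreal (normal_density 0 \<sigma> x))"
    using u unfolding gaussian_errors_def by auto
  have rv [measurable]: "(\<lambda>\<omega>. u \<omega> $ j) \<in> borel_measurable M" if "j < n" for j
    using distributed_measurable[OF normal[OF that]] by simp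
  have proj: "(q i \<bullet> u \<omega>) / \<sigma> = (\<Sum>j<n. q i $ j * (u \<omega> $ j / \<sigma>))" if "i \<in> I" "\<omega> \<in> space M" for i \<omega>
    using carr[OF that(2)] by (simp add: scalar_prod_def sum_divide_distrib lessThan_atLeast0)
  show "(\<lambda>\<omega>. (q i \<bullet> u \<omega>) / \<sigma>) \<in> borel_measurable M" for i
    using gaussian_errors_scalar_prod_measurable[OF u] by measurable
  show "real_distribution std_normal_distribution" by (rule real_dist_normal_dist)
  fix s :: "'i \<Rightarrow> real"
  define c where "c j = (\<Sum>i\<in>I. s i * q i $ j)" for j
  have std: "distr M borel (\<lambda>\<omega>. u \<omega> $ j / \<sigma>) = std_normal_distribution" if "j < n" for j
    using distributed_distr_eq_density[OF iffD1[OF normal_standard_normal_convert[OF \<sigma>] normal[OF that]]]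
    by (simp cong: distr_cong)
  have c_sq: "(\<Sum>j<n. (c j)\<^sup>2) = (\<Sum>i\<in>I. (s i)\<^sup>2)"
  proof -
    have "(\<Sum>j<n. (c j)\<^sup>2) = (\<Sum>j<n. \<Sum>i\<in>I. \<Sum>l\<in>I. s i * s l * (q i $ j * q l $ j))"
      unfolding c_def power2_eq_square by (simp add: sum_product ac_simps)
    also have "\<dots> = (\<Sum>i\<in>I. \<Sum>l\<in>I. \<Sum>j<n. s i * s l * (q i $ j * q l $ j))"
      by (subst sum.swap) (intro sum.cong refl sum.swap)
    also have "\<dots> = (\<Sum>i\<in>I. \<Sum>l\<in>I. s i * s l * (q i \<bullet> q l))"
      by (intro sum.cong refl)
        (auto simp: scalar_prod_def sum_distrib_left lessThan_atLeast0 carrier_vecD[OF q])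
    also have "\<dots> = (\<Sum>i\<in>I. \<Sum>l\<in>I. if i = l then (s i)\<^sup>2 else 0)"
      by (intro sum.cong refl) (auto simp: orth power2_eq_square)
    also have "\<dots> = (\<Sum>i\<in>I. (s i)\<^sup>2)" using I by simp
    finally show ?thesis .
  qed
  have "(CLINT \<omega>|M. (\<Prod>i\<in>I. iexp (s i * ((q i \<bullet> u \<omega>) / \<sigma>)))) = (CLINT \<omega>|M. iexp (\<Sum>j<n. c j * (u \<omega> $ j / \<sigma>)))"
  proof (rule Bochner_Integration.integral_cong)
    fix \<omega> assume \<omega>: "\<omega> \<in> space M"
    have "(\<Prod>i\<in>I. iexp (s i * ((q i \<bullet> u \<omega>) / \<sigma>))) = iexp (\<Sum>i\<in>I. s i * ((q i \<bullet> u \<omega>) / \<sigma>))"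
      using I by (simp add: exp_sum sum_distrib_left)
    also have "(\<Sum>i\<in>I. s i * ((q i \<bullet> u \<omega>) / \<sigma>)) = (\<Sum>j<n. c j * (u \<omega> $ j / \<sigma>))"
      unfolding c_def sum_distrib_right
      by (subst sum.swap) (auto simp: proj[OF _ \<omega>] sum_distrib_left ac_simps intro!: sum.cong)
    finally show "(\<Prod>i\<in>I. iexp (s i * ((q i \<bullet> u \<omega>) / \<sigma>))) = iexp (\<Sum>j<n. c j * (u \<omega> $ j / \<sigma>))" .
  qed simp
  also have "\<dots> = char (distr M borel (\<lambda>\<omega>. \<Sum>j<n. c j * (u \<omega> $ j / \<sigma>))) 1"
    unfolding char_def by (subst integral_distr) auto
  also have "\<dots> = (\<Prod>j<n. char (distr M borel (\<lambda>\<omega>. c j * (u \<omega> $ j / \<sigma>))) 1)"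
    by (rule char_distr_sum, rule indep_vars_compose2[OF indep]) auto
  also have "\<dots> = (\<Prod>j<n. char std_normal_distribution (c j))"
  proof (rule prod.cong[OF refl])
    fix j assume "j \<in> {..<n}"
    then have j: "j < n" by simp
    note rv[OF j, measurable]
    show "char (distr M borel (\<lambda>\<omega>. c j * (u \<omega> $ j / \<sigma>))) 1 = char std_normal_distribution (c j)"
      unfolding std[OF j, symmetric] char_def by (subst (1 2) integral_distr) auto
  qed
  also have "\<dots> = of_real (\<Prod>j<n. exp (- (c j)\<^sup>2 / 2))"
    unfolding char_std_normal_distribution by simp
  also have "(\<Prod>j<n. exp (- (c j)\<^sup>2 / 2)) = exp (\<Sum>j<n. - (c j)\<^sup>2 / 2)"
    by (simp add: exp_sum)
  also have "(\<Sum>j<n. - (c j)\<^sup>2 / 2) = (\<Sum>i\<in>I. - (s i)\<^sup>2 / 2)"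
    using c_sq by (simp add: sum_negf flip: sum_divide_distrib)
  also have "exp (\<Sum>i\<in>I. - (s i)\<^sup>2 / 2) = (\<Prod>i\<in>I. exp (- (s i)\<^sup>2 / 2))"
    using I by (simp add: exp_sum)
  finally show "(CLINT \<omega>|M. (\<Prod>i\<in>I. iexp (s i * ((q i \<bullet> u \<omega>) / \<sigma>)))) = (\<Prod>i\<in>I. char std_normal_distribution (s i))"
    unfolding char_std_normal_distribution by simp
qed

section \<open>The chi-square distribution\<close>

interpretation std_normal: real_distribution std_normal_distribution
  by (rule real_dist_normal_dist)

lemma product_prob_space_std_normal: "product_prob_space (\<lambda>_ :: nat. std_normal_distribution)"
  by standard

lemma sum_squares_measurable [measurable]:
  "J \<subseteq> I \<Longrightarrow> (\<lambda>x. \<Sum>j\<in>J. (x j)\<^sup>2) \<in> borel_measurable (PiM I (\<lambda>_ :: nat. std_normal_distribution))"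
  by (intro borel_measurable_sum borel_measurable_power) (measurable, auto)

lemma real_distribution_chi_square: "real_distribution (chi_square m)"
  unfolding chi_square_def
  by (intro prob_space.real_distribution_distr prob_space_PiM std_normal.prob_space_axioms) simp

interpretation chi_square: real_distribution "chi_square m" for m
  by (rule real_distribution_chi_square)

lemma AE_chi_square_nonneg: "AE q in chi_square m. 0 \<le> q"
  unfolding chi_square_def by (subst AE_distr_iff) (auto intro!: sum_nonneg)

text \<open>The last coordinate of a standard Gaussian vector is independent of the sum of squares of the others.
  This serves both to identify the joint law of the pivots and, as \<open>chi_square_Suc\<close>, to analyse
  the chi-square law by recursion.\<close>

lemma law_coordinate_sum_squares:
  "distr (PiM {..<Suc m} (\<lambda>_. std_normal_distribution)) (borel \<Otimes>\<^sub>M borel) (\<lambda>x. (x m, \<Sum>j<m. (x j)\<^sup>2))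
    = std_normal_distribution \<Otimes>\<^sub>M chi_square m" (is "distr ?P _ ?f = _")
proof (rule measure_eqI)
  interpret product_prob_space "\<lambda>_ :: nat. std_normal_distribution"
    by (rule product_prob_space_std_normal)
  have f [measurable]: "?f \<in> measurable ?P (borel \<Otimes>\<^sub>M borel)"
    by (intro measurable_Pair sum_squares_measurable) auto
  show "sets (distr ?P (borel \<Otimes>\<^sub>M borel) ?f) = sets (std_normal_distribution \<Otimes>\<^sub>M chi_square m)"
    unfolding sets_distr by (rule sets_pair_measure_cong) auto
  fix A assume "A \<in> sets (distr ?P (borel \<Otimes>\<^sub>M borel) ?f)"
  then have A [measurable]: "A \<in> sets (borel \<Otimes>\<^sub>M borel)" by simp
  have A' [measurable]: "A \<in> sets (std_normal_distribution \<Otimes>\<^sub>M chi_square m)"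
    using A by (simp cong: sets_pair_measure_cong)
  have "emeasure (distr ?P (borel \<Otimes>\<^sub>M borel) ?f) A = (\<integral>\<^sup>+z. indicator A z \<partial>distr ?P (borel \<Otimes>\<^sub>M borel) ?f)"
    by simp
  also have "\<dots> = (\<integral>\<^sup>+x. indicator A (?f x) \<partial>?P)"
    by (rule nn_integral_distr) auto
  also have "\<dots> = (\<integral>\<^sup>+x. indicator A (?f x) \<partial>PiM (insert m {..<m}) (\<lambda>_. std_normal_distribution))"
    by (simp add: lessThan_Suc)
  also have "\<dots> = (\<integral>\<^sup>+y. (\<integral>\<^sup>+x. indicator A (?f (x(m := y))) \<partial>PiM {..<m} (\<lambda>_. std_normal_distribution)) \<partial>std_normal_distribution)"
    by (rule product_nn_integral_insert_rev) (use f in \<open>auto simp: lessThan_Suc\<close>)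
  also have "\<dots> = (\<integral>\<^sup>+y. (\<integral>\<^sup>+x. indicator A (y, \<Sum>j<m. (x j)\<^sup>2) \<partial>PiM {..<m} (\<lambda>_. std_normal_distribution)) \<partial>std_normal_distribution)"
    by simp
  also have "\<dots> = (\<integral>\<^sup>+y. (\<integral>\<^sup>+q. indicator A (y, q) \<partial>chi_square m) \<partial>std_normal_distribution)"
    unfolding chi_square_def by (intro nn_integral_cong nn_integral_distr[symmetric]) auto
  also have "\<dots> = (\<integral>\<^sup>+z. indicator A z \<partial>(std_normal_distribution \<Otimes>\<^sub>M chi_square m))"
    by (rule chi_square.nn_integral_fst) simp
  also have "\<dots> = emeasure (std_normal_distribution \<Otimes>\<^sub>M chi_square m) A" by simp
  finally show "emeasure (distr ?P (borel \<Otimes>\<^sub>M borel) ?f) A = emeasure (std_normal_distribution \<Otimes>\<^sub>M chi_square m) A" .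
qed

lemma chi_square_Suc:
  "chi_square (Suc m) = distr (std_normal_distribution \<Otimes>\<^sub>M chi_square m) borel (\<lambda>(g, q). g\<^sup>2 + q)"
  unfolding law_coordinate_sum_squares[symmetric]
  by (subst distr_distr) (auto simp: chi_square_def comp_def add.commute intro!: measurable_Pair)

lemma null_sets_lborel_of_negligible:
  fixes A :: "real set"
  assumes "A \<in> sets borel" "negligible B" "A \<subseteq> B"
  shows "A \<in> null_sets lborel"
  using assms negligible_subset[of B A] negligible_iff_null_sets[of A] null_sets_completion_iff[of A lborel]
  by auto

text \<open>The preimage is covered by the images of the given null set under the two branches of
  \<open>\<plusminus> \<surd>(x - q)\<close>, which are differentiable away from \<open>x = q\<close>; the exceptional point contributes only \<open>g = 0\<close>.\<close>

lemma null_set_vimage_square_add: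
  assumes A: "A \<in> null_sets lborel"
  shows "{g :: real. g\<^sup>2 + q \<in> A} \<in> null_sets lborel"
proof (rule null_sets_lborel_of_negligible)
  have [measurable]: "A \<in> sets borel" using A by auto
  show "{g :: real. g\<^sup>2 + q \<in> A} \<in> sets borel" by measurable
  define S where "S = A \<inter> {q<..}"
  have S: "negligible S"
    unfolding S_def using A negligible_iff_null_sets[of A] null_sets_completionI[OF A]
    by (auto intro: negligible_subset)
  have "(\<lambda>x. sqrt (x - q)) differentiable_on S" "(\<lambda>x. - sqrt (x - q)) differentiable_on S"
    unfolding differentiable_on_def S_def real_differentiable_def differentiable_def
    by (auto intro!: derivative_eq_intros simp: has_field_derivative_def[symmetric])
  then have "negligible ((\<lambda>x. sqrt (x - q)) ` S)" "negligible ((\<lambda>x. - sqrt (x - q)) ` S)"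
    by (auto intro: negligible_differentiable_image_negligible[OF _ S])
  then show "negligible ({0} \<union> (\<lambda>x. sqrt (x - q)) ` S \<union> (\<lambda>x. - sqrt (x - q)) ` S)"
    by (intro negligible_Un) auto
  show "{g :: real. g\<^sup>2 + q \<in> A} \<subseteq> {0} \<union> (\<lambda>x. sqrt (x - q)) ` S \<union> (\<lambda>x. - sqrt (x - q)) ` S"
  proof
    fix g assume g: "g \<in> {g :: real. g\<^sup>2 + q \<in> A}"
    show "g \<in> {0} \<union> (\<lambda>x. sqrt (x - q)) ` S \<union> (\<lambda>x. - sqrt (x - q)) ` S"
    proof (cases "g = 0")
      case False
      then have "g\<^sup>2 + q \<in> S" using g by (auto simp: S_def)
      moreover have "g = sqrt (g\<^sup>2 + q - q) \<or> g = - sqrt (g\<^sup>2 + q - q)" by (auto simp: real_sqrt_abs)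
      ultimately show ?thesis by blast
    qed simp
  qed
qed

text \<open>Conditionally on all but one of the squared coordinates, the sum is a shifted square of an absolutely
  continuous variable.\<close>

lemma chi_square_absolutely_continuous:
  assumes "1 \<le> m"
  shows "absolutely_continuous lborel (chi_square m)"
proof -
  obtain m' where m: "m = Suc m'" using assms by (cases m) auto
  show ?thesis
    unfolding absolutely_continuous_def
  proof
    fix A :: "real set" assume A: "A \<in> null_sets lborel"
    then have A' [measurable]: "A \<in> sets borel" by auto
    have null: "emeasure std_normal_distribution {g. g\<^sup>2 + q \<in> A} = 0" for q
    proof -
      have "{g. g\<^sup>2 + q \<in> A} \<in> null_sets std_normal_distribution"
        using null_set_vimage_square_add[OF A, of q]
          absolutely_continuousI_density[of "\<lambda>x. ennreal (std_normal_density x)" lborel]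
        unfolding absolutely_continuous_def by auto
      then show ?thesis by auto
    qed
    interpret pair_sigma_finite std_normal_distribution "chi_square m'" ..
    have "emeasure (chi_square m) A = emeasure (std_normal_distribution \<Otimes>\<^sub>M chi_square m') ((\<lambda>(g, q). g\<^sup>2 + q) -` A \<inter> space (std_normal_distribution \<Otimes>\<^sub>M chi_square m'))"
      unfolding m chi_square_Suc by (rule emeasure_distr) auto
    also have "\<dots> = (\<integral>\<^sup>+q. emeasure std_normal_distribution ((\<lambda>g. (g, q)) -` ((\<lambda>(g, q). g\<^sup>2 + q) -` A \<inter> space (std_normal_distribution \<Otimes>\<^sub>M chi_square m'))) \<partial>chi_square m')"
      by (rule emeasure_pair_measure_alt2) measurable
    also have "\<dots> = (\<integral>\<^sup>+q. 0 \<partial>chi_square m')"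
      by (intro nn_integral_cong) (simp add: space_pair_measure null vimage_def)
    finally show "A \<in> null_sets (chi_square m)" by (auto simp: null_sets_def)
  qed
qed

lemma chi_square_no_atoms: "1 \<le> m \<Longrightarrow> measure (chi_square m) {x} = 0"
proof -
  assume "1 \<le> m"
  moreover have "{x} \<in> null_sets lborel" by (auto simp: null_sets_def)
  ultimately have "{x} \<in> null_sets (chi_square m)"
    using chi_square_absolutely_continuous[of m] unfolding absolutely_continuous_def by blast
  then show ?thesis by (simp add: measure_eq_0_null_sets)
qed

lemma real_distribution_chi_scaled: "real_distribution (chi_scaled m)"
  unfolding chi_scaled_def by (rule chi_square.real_distribution_distr) simp

interpretation chi_scaled: real_distribution "chi_scaled m" for m
  by (rule real_distribution_chi_scaled)

text \<open>This is what makes the Radon-Nikodym derivative in \<open>rho\<close> an actual density. The scaling map is inverted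
  by the smooth map \<open>s \<mapsto> m s\<^sup>2\<close>, which preserves null sets.\<close>

lemma chi_scaled_absolutely_continuous:
  assumes m: "1 \<le> m"
  shows "absolutely_continuous lborel (chi_scaled m)"
  unfolding absolutely_continuous_def
proof
  fix A :: "real set" assume A: "A \<in> null_sets lborel"
  then have A' [measurable]: "A \<in> sets borel" by auto
  define B where "B = {x :: real. 0 \<le> x \<and> sqrt x / sqrt (real m) \<in> A}"
  have "negligible A" using null_sets_completionI[OF A] by (simp add: negligible_iff_null_sets)
  moreover have "(\<lambda>s. real m * s\<^sup>2) differentiable_on A"
    unfolding differentiable_on_def by (auto intro!: derivative_intros)
  ultimately have neg: "negligible ((\<lambda>s. real m * s\<^sup>2) ` A)"
    by (rule negligible_differentiable_image_negligible[rotated]) simp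
  have "B \<in> null_sets lborel"
  proof (rule null_sets_lborel_of_negligible[OF _ neg])
    show "B \<in> sets borel" unfolding B_def by measurable
    show "B \<subseteq> (\<lambda>s. real m * s\<^sup>2) ` A"
      using m by (auto simp: B_def power_divide intro!: image_eqI[of _ _ "sqrt x / sqrt (real m)" for x])
  qed
  then have "B \<in> null_sets (chi_square m)"
    using chi_square_absolutely_continuous[OF m] unfolding absolutely_continuous_def by auto
  then have "AE x in chi_square m. x \<notin> B" by (rule AE_not_in)
  then have "AE x in chi_square m. sqrt x / sqrt (real m) \<notin> A"
    using AE_chi_square_nonneg[of m] by eventually_elim (auto simp: B_def)
  then have "AE s in chi_scaled m. s \<notin> A"
    unfolding chi_scaled_def by (subst AE_distr_iff) auto
  then show "A \<in> null_sets (chi_scaled m)"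
    by (subst (asm) AE_iff_null_sets[symmetric]) auto
qed

lemma measure_chi_scaled_greater:
  assumes m: "1 \<le> m" and a: "0 \<le> a"
  shows "measure (chi_scaled m) {s. a < ereal s} = measure (chi_square m) {x. ereal x > ereal (real m) * a\<^sup>2}"
proof -
  have meas [measurable]: "{s. a < ereal s} \<in> sets borel" for a :: ereal by measurable
  have eq: "a < ereal (sqrt x / sqrt (real m)) \<longleftrightarrow> ereal (real m) * a\<^sup>2 < ereal x" if "0 \<le> x" for x
  proof (cases a)
    case (real b)
    then have b: "0 \<le> b" using a by simp
    have "b < sqrt x / sqrt (real m) \<longleftrightarrow> b < sqrt (x / real m)" by (simp add: real_sqrt_divide)
    also have "\<dots> \<longleftrightarrow> sqrt (b\<^sup>2) < sqrt (x / real m)" using b by simp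
    also have "\<dots> \<longleftrightarrow> b\<^sup>2 < x / real m" by (rule real_sqrt_less_iff)
    also have "\<dots> \<longleftrightarrow> real m * b\<^sup>2 < x" using m by (simp add: field_simps)
    finally show ?thesis unfolding real by simp
  next
    case PInf
    then show ?thesis using m by (simp add: ereal_mult_infty)
  qed (use a in auto)
  have "measure (chi_scaled m) {s. a < ereal s} = measure (chi_square m) {x. a < ereal (sqrt x / sqrt (real m))}"
    unfolding chi_scaled_def by (subst measure_distr) (auto simp: vimage_def)
  also have "\<dots> = measure (chi_square m) {x. ereal x > ereal (real m) * a\<^sup>2}"
    by (rule chi_square.finite_measure_eq_AE)
       (use AE_chi_square_nonneg[of m] in \<open>auto simp: eq elim!: eventually_mono\<close>)
  finally show ?thesis .
qed

lemma LBINT_rho: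
  assumes m: "1 \<le> m"
  shows "(LBINT s=\<bar>\<zeta>\<bar>..\<infinity>. rho m s) = measure (chi_square m) {x. ereal x > ereal (real m) * \<zeta>\<^sup>2}"
proof -
  have "(LBINT s=\<bar>\<zeta>\<bar>..\<infinity>. rho m s) = (LINT s|lborel. indicator (einterval \<bar>\<zeta>\<bar> \<infinity>) s * rho m s)"
    by (simp add: interval_lebesgue_integral_def set_lebesgue_integral_def)
  also have "\<dots> = (LINT s|lborel. enn2real (RN_deriv lborel (chi_scaled m) s) * indicator {s. \<bar>\<zeta>\<bar> < ereal s} s)"
  proof (rule Bochner_Integration.integral_cong[OF refl])
    fix s :: real
    have "0 \<le> s" if "\<bar>\<zeta>\<bar> < ereal s"
    proof -
      have "0 \<le> \<bar>\<zeta>\<bar>" by (cases \<zeta>) auto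
      then show ?thesis using that by (metis ereal_less_eq(5) less_imp_le order.trans)
    qed
    then show "indicator (einterval \<bar>\<zeta>\<bar> \<infinity>) s * rho m s
        = enn2real (RN_deriv lborel (chi_scaled m) s) * indicator {s. \<bar>\<zeta>\<bar> < ereal s} s"
      by (auto simp: rho_def einterval_def indicator_def)
  qed
  also have "\<dots> = (LINT s|chi_scaled m. indicator {s. \<bar>\<zeta>\<bar> < ereal s} s)"
    by (rule sigma_finite_measure.RN_deriv_integral[symmetric, OF sigma_finite_lborel])
       (use chi_scaled_absolutely_continuous[OF m] in \<open>auto intro: chi_scaled.sigma_finite_measure_axioms\<close>)
  also have "\<dots> = measure (chi_scaled m) {s. \<bar>\<zeta>\<bar> < ereal s}"
    by simp
  also have "\<dots> = measure (chi_square m) {x. ereal x > ereal (real m) * \<bar>\<zeta>\<bar>\<^sup>2}"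
    by (rule measure_chi_scaled_greater[OF m]) simp
  also have "\<bar>\<zeta>\<bar>\<^sup>2 = \<zeta>\<^sup>2" by (cases \<zeta>) (auto simp: power2_eq_square)
  finally show ?thesis .
qed

section \<open>Normal limits of chi-square tails\<close>

lemma std_normal_distr_uminus: "distr std_normal_distribution borel uminus = std_normal_distribution"
proof -
  have "distributed std_normal_distribution lborel (\<lambda>x. x) (\<lambda>x. ennreal (std_normal_density x))"
    by (auto simp: distributed_def distr_id2 intro!: distr_id2)
  from std_normal.normal_density_affine[OF this, of "-1" 0]
  have "distributed std_normal_distribution lborel uminus (\<lambda>x. ennreal (std_normal_density x))" by simp
  then show ?thesis by (auto simp: distributed_def cong: distr_cong)
qed

lemma std_normal_integral_reflect:
  fixes f :: "real \<Rightarrow> real"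
  assumes "f \<in> borel_measurable borel"
  shows "(LINT g|std_normal_distribution. f (- g)) = (LINT g|std_normal_distribution. f g)"
  by (subst (2) std_normal_distr_uminus[symmetric]) (simp add: integral_distr assms)

lemma std_normal_no_atoms: "measure std_normal_distribution {x} = 0"
proof -
  have "{x} \<in> null_sets lborel" by (auto simp: null_sets_def)
  then have "{x} \<in> null_sets std_normal_distribution"
    using absolutely_continuousI_density[of "\<lambda>x. ennreal (std_normal_density x)" lborel]
    unfolding absolutely_continuous_def by (auto simp: subset_eq)
  then show ?thesis by (simp add: measure_eq_0_null_sets)
qed

lemma isCont_std_normal_cdf: "isCont (cdf std_normal_distribution) x"
  using std_normal.isCont_cdf std_normal_no_atoms by blast

lemma Phi_simps [simp]: "Phi (ereal r) = cdf std_normal_distribution r" "Phi \<infinity> = 1" "Phi (- \<infinity>) = 0"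
  by (simp_all add: Phi_def)

text \<open>This formula also holds at infinite arguments, so that \<open>Phi\<close> can be used in limits without case
  distinctions.\<close>

lemma Phi_measure: "Phi x = measure std_normal_distribution {g. ereal g \<le> x}"
  by (cases x) (auto simp: cdf_def2 atMost_def std_normal.prob_space[simplified])

lemma Phi_uminus: "Phi (- x) = 1 - Phi x"
proof (cases x)
  case (real r)
  have "cdf std_normal_distribution (- r) = measure std_normal_distribution {r..}"
    unfolding cdf_def2 by (subst std_normal_distr_uminus[symmetric]) (auto simp: measure_distr intro!: arg_cong2[where f = measure])
  also have "{r..} = {r} \<union> {r<..}" by auto
  also have "measure std_normal_distribution \<dots> = measure std_normal_distribution {r<..}"
    using std_normal.finite_measure_Union[of "{r}" "{r<..}"] std_normal_no_atoms[of r] by simp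
  also have "{r<..} = UNIV - {..r}" by auto
  also have "measure std_normal_distribution \<dots> = 1 - cdf std_normal_distribution r"
    using std_normal.prob_compl[of "{..r}"] unfolding cdf_def2 by simp
  finally show ?thesis using real by simp
qed simp_all

lemma mono_Phi: "x \<le> y \<Longrightarrow> Phi x \<le> Phi y"
  unfolding Phi_measure by (intro std_normal.finite_measure_mono) auto

text \<open>The chi-square law with \<open>n\<close> degrees of freedom is the law of a sum of \<open>n\<close> independent squares, each of
  mean 1 and variance \<open>3 - 1 = 2\<close>; an infinite product space provides all of them at once.\<close>

lemma chi_square_clt:
  "weak_conv_m (\<lambda>n. distr (chi_square n) borel (\<lambda>q. (q - real n) / sqrt (real n * 2))) std_normal_distribution"
proof -
  interpret product_prob_space "\<lambda>_ :: nat. std_normal_distribution" UNIV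
    by (rule product_prob_space_std_normal)
  let ?P = "PiM UNIV (\<lambda>_ :: nat. std_normal_distribution)"
  have coord [measurable]: "(\<lambda>x. x i) \<in> borel_measurable ?P" for i by measurable
  have law: "distr ?P borel (\<lambda>x. x i) = std_normal_distribution" for i
  proof -
    have "distr ?P borel (\<lambda>x. x i) = distr ?P std_normal_distribution (\<lambda>x. x i)"
      by (rule distr_cong) auto
    then show ?thesis using PiM_component[of i] by simp
  qed
  have "indep_vars (\<lambda>_. borel) (\<lambda>i x. x i) UNIV"
  proof (subst indep_vars_iff_distr_eq_PiM')
    show "distr ?P (PiM UNIV (\<lambda>_. borel)) (\<lambda>x. \<lambda>i\<in>UNIV. x i) = PiM UNIV (\<lambda>i. distr ?P borel (\<lambda>x. x i))"
      unfolding law by (simp add: restrict_UNIV, rule distr_id2) (auto intro!: sets_PiM_cong)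
  qed auto
  then have indep: "indep_vars (\<lambda>_. borel) (\<lambda>i x. (x i)\<^sup>2) UNIV"
    by (rule indep_vars_compose2) auto
  have E: "(LINT x|?P. f (x i)) = (LINT g|std_normal_distribution. f g)"
    if "f \<in> borel_measurable borel" for f :: "real \<Rightarrow> real" and i
  proof -
    have "(LINT x|?P. f (x i)) = (LINT g|distr ?P borel (\<lambda>x. x i). f g)"
      using that by (intro integral_distr[symmetric]) auto
    then show ?thesis by (simp only: law)
  qed
  have I: "integrable ?P (\<lambda>x. (x i) ^ k)" for i k
  proof -
    have "integrable (distr ?P borel (\<lambda>x. x i)) (\<lambda>g. g ^ k)"
      unfolding law by (rule integrable_std_normal_distribution_moment)
    then show ?thesis by (subst (asm) integrable_distr_eq) auto
  qed
  have m2: "(LINT x|?P. (x i)\<^sup>2) = 1" for i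
    using E[of "\<lambda>g. g\<^sup>2" i] std_normal_distribution_even_moments(1)[of 1] by simp
  have m4: "(LINT x|?P. ((x i)\<^sup>2)\<^sup>2) = 3" for i
    using E[of "\<lambda>g. g ^ 4" i] std_normal_distribution_even_moments(1)[of 2]
    by (simp add: fact_numeral)
  have var: "variance (\<lambda>x. (x i)\<^sup>2) = (sqrt 2)\<^sup>2" for i
    using I[of i 2] I[of i 4] m2[of i] m4[of i] by (subst variance_eq) auto
  have "weak_conv_m (\<lambda>n. distr ?P borel (\<lambda>x. (\<Sum>i<n. (x i)\<^sup>2 - 1) / sqrt (real n * (sqrt 2)\<^sup>2))) std_normal_distribution"
  proof (rule central_limit_theorem[OF indep m2 _ _ var])
    show "integrable ?P (\<lambda>x. ((x n)\<^sup>2)\<^sup>2)" for n using I[of n 4] by simp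
    show "distr ?P borel (\<lambda>x. (x n)\<^sup>2) = distr std_normal_distribution borel (\<lambda>g. g\<^sup>2)" for n
    proof -
      have "distr ?P borel (\<lambda>x. (x n)\<^sup>2) = distr (distr ?P borel (\<lambda>x. x n)) borel (\<lambda>g. g\<^sup>2)"
        by (subst distr_distr) (auto simp: comp_def)
      then show ?thesis by (simp only: law)
    qed
  qed auto
  moreover have "distr ?P borel (\<lambda>x. (\<Sum>i<n. (x i)\<^sup>2 - 1) / sqrt (real n * (sqrt 2)\<^sup>2))
      = distr (chi_square n) borel (\<lambda>q. (q - real n) / sqrt (real n * 2))" for n
  proof -
    have "chi_square n = distr (distr ?P (PiM {..<n} (\<lambda>_. std_normal_distribution)) (\<lambda>x. restrict x {..<n})) borel (\<lambda>x. \<Sum>j<n. (x j)\<^sup>2)"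
      unfolding chi_square_def by (subst distr_PiM_restrict_finite) auto
    also have "\<dots> = distr ?P borel (\<lambda>x. \<Sum>j<n. (x j)\<^sup>2)"
      by (subst distr_distr) (auto simp: comp_def intro!: measurable_restrict_subset)
    finally show ?thesis
      by (simp add: distr_distr comp_def sum_subtractf)
  qed
  ultimately show ?thesis by simp
qed

text \<open>Convergence of distribution functions along a moving argument. Only monotonicity and continuity of the
  limit are used, and the argument may drift to infinity.\<close>

lemma cdf_tendsto_Phi:
  fixes D :: "nat \<Rightarrow> real measure"
  assumes D: "\<And>n. real_distribution (D n)"
    and conv: "\<And>y. (\<lambda>n. cdf (D n) y) \<longlonglongrightarrow> cdf std_normal_distribution y"
    and x: "(\<lambda>n. ereal (x n)) \<longlonglongrightarrow> x0"
  shows "(\<lambda>n. cdf (D n) (x n)) \<longlonglongrightarrow> Phi x0"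
proof (rule order_tendstoI)
  interpret D: real_distribution "D n" for n by (rule D)
  fix a assume a: "a < Phi x0"
  have "\<exists>y. ereal y < x0 \<and> a < cdf std_normal_distribution y \<or> a < 0"
  proof (cases x0)
    case (real r)
    have "eventually (\<lambda>y. a < cdf std_normal_distribution y) (at_left r)"
      using a real isCont_std_normal_cdf[of r]
      by (intro order_tendstoD(1)[of _ "cdf std_normal_distribution r"]) (auto simp: isCont_def intro: tendsto_within_subset)
    moreover have "eventually (\<lambda>y. y < r) (at_left r)" by (simp add: eventually_at_filter)
    ultimately have "eventually (\<lambda>y. a < cdf std_normal_distribution y \<and> y < r) (at_left r)"
      by eventually_elim auto
    then obtain y where "a < cdf std_normal_distribution y \<and> y < r"
      using eventually_happens'[of "at_left r"] by auto
    then show ?thesis using real by auto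
  next
    case PInf
    have "eventually (\<lambda>y. a < cdf std_normal_distribution y) at_top"
      using a PInf std_normal.cdf_lim_at_top_prob by (intro order_tendstoD) auto
    then obtain y where "a < cdf std_normal_distribution y"
      using eventually_happens'[of "at_top :: real filter"] by auto
    then show ?thesis using PInf by auto
  qed (use a in auto)
  then consider y where "ereal y < x0" "a < cdf std_normal_distribution y" | "a < 0" by auto
  then show "\<forall>\<^sub>F n in sequentially. a < cdf (D n) (x n)"
  proof cases
    case 1
    have "\<forall>\<^sub>F n in sequentially. ereal y < ereal (x n)" by (rule order_tendstoD(1)[OF x 1(1)])
    moreover have "\<forall>\<^sub>F n in sequentially. a < cdf (D n) y" by (rule order_tendstoD(1)[OF conv 1(2)])
    ultimately show ?thesis
      by eventually_elim (auto intro: less_le_trans[OF _ D.cdf_nondecreasing])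
  next
    case 2 then show ?thesis by (auto intro!: always_eventually less_le_trans[OF _ D.cdf_nonneg])
  qed
next
  interpret D: real_distribution "D n" for n by (rule D)
  fix a assume a: "Phi x0 < a"
  have "\<exists>y. x0 < ereal y \<and> cdf std_normal_distribution y < a \<or> 1 < a"
  proof (cases x0)
    case (real r)
    have "eventually (\<lambda>y. cdf std_normal_distribution y < a) (at_right r)"
      using a real isCont_std_normal_cdf[of r]
      by (intro order_tendstoD(2)[of _ "cdf std_normal_distribution r"]) (auto simp: isCont_def intro: tendsto_within_subset)
    moreover have "eventually (\<lambda>y. y > r) (at_right r)" by (simp add: eventually_at_filter)
    ultimately have "eventually (\<lambda>y. cdf std_normal_distribution y < a \<and> y > r) (at_right r)"
      by eventually_elim auto
    then obtain y where "cdf std_normal_distribution y < a \<and> y > r"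
      using eventually_happens'[of "at_right r"] by auto
    then show ?thesis using real by auto
  next
    case MInf
    have "eventually (\<lambda>y. cdf std_normal_distribution y < a) at_bot"
      using a MInf std_normal.cdf_lim_at_bot by (intro order_tendstoD) auto
    then obtain y where "cdf std_normal_distribution y < a"
      using eventually_happens'[of "at_bot :: real filter"] by auto
    then show ?thesis using MInf by auto
  qed (use a in auto)
  then consider y where "x0 < ereal y" "cdf std_normal_distribution y < a" | "1 < a" by auto
  then show "\<forall>\<^sub>F n in sequentially. cdf (D n) (x n) < a"
  proof cases
    case 1
    have "\<forall>\<^sub>F n in sequentially. ereal (x n) < ereal y" by (rule order_tendstoD(2)[OF x 1(1)])
    moreover have "\<forall>\<^sub>F n in sequentially. cdf (D n) y < a" by (rule order_tendstoD(2)[OF conv 1(2)])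
    ultimately show ?thesis
      by eventually_elim (rule le_less_trans[OF D.cdf_nondecreasing], auto)
  next
    case 2 then show ?thesis by (auto intro!: always_eventually le_less_trans[OF D.cdf_bounded_prob])
  qed
qed

lemma measure_chi_square_atLeast: "1 \<le> m \<Longrightarrow> measure (chi_square m) {a..} = 1 - cdf (chi_square m) a"
proof -
  assume m: "1 \<le> m"
  have "{a..} = {a} \<union> {a<..}" by auto
  also have "measure (chi_square m) \<dots> = measure (chi_square m) {a<..}"
    using chi_square.finite_measure_Union[of "{a}" m "{a<..}"] chi_square_no_atoms[OF m, of a] by simp
  also have "{a<..} = UNIV - {..a}" by auto
  also have "measure (chi_square m) \<dots> = 1 - cdf (chi_square m) a"
    using chi_square.prob_compl[of "{..a}" m] chi_square.space_eq_univ unfolding cdf_def2 by simp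
  finally show ?thesis .
qed

text \<open>The central limit theorem in the form in which it is applied: for a threshold that varies with the
  degrees of freedom.\<close>

lemma chi_square_tail_tendsto:
  assumes \<nu>: "filterlim \<nu> at_top sequentially"
    and a: "(\<lambda>n. ereal ((a n - real (\<nu> n)) / sqrt (real (\<nu> n) * 2))) \<longlonglongrightarrow> x0"
  shows "(\<lambda>n. measure (chi_square (\<nu> n)) {a n..}) \<longlonglongrightarrow> Phi (- x0)"
proof -
  define D where "D m = distr (chi_square m) borel (\<lambda>q. (q - real m) / sqrt (real m * 2))" for m
  have D: "real_distribution (D m)" for m unfolding D_def by (rule chi_square.real_distribution_distr) simp
  have "(\<lambda>m. cdf (D m) y) \<longlonglongrightarrow> cdf std_normal_distribution y" for y
    using chi_square_clt isCont_std_normal_cdf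
    unfolding weak_conv_m_def weak_conv_def D_def[symmetric] by auto
  from filterlim_compose[OF this \<nu>]
  have "(\<lambda>n. cdf (D (\<nu> n)) y) \<longlonglongrightarrow> cdf std_normal_distribution y" for y .
  then have lim: "(\<lambda>n. 1 - cdf (D (\<nu> n)) ((a n - real (\<nu> n)) / sqrt (real (\<nu> n) * 2))) \<longlonglongrightarrow> 1 - Phi x0"
    by (intro tendsto_diff tendsto_const cdf_tendsto_Phi[OF D _ a])
  have "1 - cdf (D m) ((b - real m) / sqrt (real m * 2)) = measure (chi_square m) {b..}" if "1 \<le> m" for m b
  proof -
    have "cdf (D m) ((b - real m) / sqrt (real m * 2)) = cdf (chi_square m) b"
      using that unfolding D_def cdf_def2 by (simp add: measure_distr vimage_def divide_le_cancel atMost_def)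
    then show ?thesis using measure_chi_square_atLeast[OF that] by simp
  qed
  moreover have "\<forall>\<^sub>F n in sequentially. 1 \<le> \<nu> n"
    using \<nu> by (auto simp: filterlim_at_top)
  ultimately have "\<forall>\<^sub>F n in sequentially. 1 - cdf (D (\<nu> n)) ((a n - real (\<nu> n)) / sqrt (real (\<nu> n) * 2)) = measure (chi_square (\<nu> n)) {a n..}"
    by (auto elim: eventually_mono)
  with lim show ?thesis unfolding Phi_uminus by (rule Lim_transform_eventually)
qed

section \<open>The probability of estimating zero\<close>

lemma tendsto_MInfty_eq_at_bot:
  "((\<lambda>x. ereal (f x)) \<longlongrightarrow> - \<infinity>) F \<longleftrightarrow> filterlim f at_bot F"
  by (simp add: tendsto_MInfty filterlim_at_bot_dense)

text \<open>The probability of \<open>\<bar>G / c + z\<bar> \<le> \<surd>(Q / \<nu>)\<close> for independent \<open>G\<close> standard normal and \<open>Q\<close> chi-square with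
  \<open>\<nu>\<close> degrees of freedom, written as an integral over the values of \<open>G\<close>. It is the probability that
  hard thresholding returns zero.\<close>

definition zero_prob :: "nat \<Rightarrow> real \<Rightarrow> real \<Rightarrow> real" where
  "zero_prob \<nu> c z =
    (LINT g|std_normal_distribution. measure (chi_square \<nu>) {real \<nu> * (g / c + z)\<^sup>2..})"

lemma chi_square_tail_measurable [measurable]:
  "(\<lambda>a. measure (chi_square \<nu>) {a..}) \<in> borel_measurable borel"
proof -
  have "mono (\<lambda>a. - measure (chi_square \<nu>) {a..})"
    by (auto intro!: monoI chi_square.finite_measure_mono)
  from borel_measurable_mono[OF this] show ?thesis
    using borel_measurable_uminus_eq by blast
qed

text \<open>Dominated convergence, with the constant 1 as a bound: limits may be computed for fixed \<open>g\<close>.\<close>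

lemma zero_prob_tendsto:
  assumes lim: "AE g in std_normal_distribution.
      (\<lambda>n. measure (chi_square (\<nu> n)) {real (\<nu> n) * (g / c n + z n)\<^sup>2..}) \<longlonglongrightarrow> h g"
    and h [measurable]: "h \<in> borel_measurable borel"
  shows "(\<lambda>n. zero_prob (\<nu> n) (c n) (z n)) \<longlonglongrightarrow> (LINT g|std_normal_distribution. h g)"
  unfolding zero_prob_def
proof (rule integral_dominated_convergence[where w = "\<lambda>_. 1"])
  show "(\<lambda>g. measure (chi_square (\<nu> n)) {real (\<nu> n) * (g / c n + z n)\<^sup>2..}) \<in> borel_measurable std_normal_distribution" for n
    using measurable_compose[OF _ chi_square_tail_measurable, of "\<lambda>g. real (\<nu> n) * (g / c n + z n)\<^sup>2" "borel" "\<nu> n"]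
    by simp
  show "AE g in std_normal_distribution. norm (measure (chi_square (\<nu> n)) {real (\<nu> n) * (g / c n + z n)\<^sup>2..}) \<le> 1" for n
    by (intro AE_I2) simp
  show "h \<in> borel_measurable std_normal_distribution" using h by simp
  show "integrable std_normal_distribution (\<lambda>_. 1 :: real)" by simp
qed (rule lim)

text \<open>Symmetry of the normal law; it transfers the results for \<open>\<zeta> = 1\<close> to \<open>\<zeta> = - 1\<close>.\<close>

lemma zero_prob_reflect: "zero_prob \<nu> c (- z) = zero_prob \<nu> c z"
proof -
  have "(- g / c + z)\<^sup>2 = (g / c + - z)\<^sup>2" for g by (simp add: power2_eq_square algebra_simps)
  then have "zero_prob \<nu> c (- z) = (LINT g|std_normal_distribution. measure (chi_square \<nu>) {real \<nu> * (- g / c + z)\<^sup>2..})"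
    unfolding zero_prob_def by simp
  also have "\<dots> = zero_prob \<nu> c z"
    unfolding zero_prob_def
    by (rule std_normal_integral_reflect[where f = "\<lambda>g. measure (chi_square \<nu>) {real \<nu> * (g / c + z)\<^sup>2..}"])
       (use measurable_compose[OF _ chi_square_tail_measurable, of "\<lambda>g. real \<nu> * (g / c + z)\<^sup>2" "borel" \<nu>] in simp)
  finally show ?thesis .
qed

lemma perturbed_tendsto:
  assumes c: "filterlim c at_top sequentially" and z: "(\<lambda>n. ereal (z n)) \<longlonglongrightarrow> \<zeta>"
  shows "(\<lambda>n. ereal (g / c n + z n)) \<longlonglongrightarrow> \<zeta>"
proof -
  have "(\<lambda>n. g / c n) \<longlonglongrightarrow> 0"
    by (rule tendsto_divide_0[OF tendsto_const filterlim_at_top_imp_at_infinity[OF c]])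
  then have "(\<lambda>n. ereal (g / c n)) \<longlonglongrightarrow> 0" by (simp add: zero_ereal_def)
  then have "(\<lambda>n. ereal (g / c n) + ereal (z n)) \<longlonglongrightarrow> 0 + \<zeta>"
    by (intro tendsto_add_ereal_general z) auto
  then show ?thesis by simp
qed

text \<open>For fixed degrees of freedom the perturbation \<open>g / c\<close> disappears and only the absence of atoms in the
  chi-square law matters. For infinite \<open>\<zeta>\<close> the threshold escapes to infinity.\<close>

lemma zero_prob_fixed_df:
  assumes m: "1 \<le> m" and c: "filterlim c at_top sequentially" and z: "(\<lambda>n. ereal (z n)) \<longlonglongrightarrow> \<zeta>"
  shows "(\<lambda>n. zero_prob m (c n) (z n)) \<longlonglongrightarrow> measure (chi_square m) {x. ereal x > ereal (real m) * \<zeta>\<^sup>2}"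
proof -
  have "(\<lambda>n. measure (chi_square m) {real m * (g / c n + z n)\<^sup>2..})
      \<longlonglongrightarrow> measure (chi_square m) {x. ereal x > ereal (real m) * \<zeta>\<^sup>2}" for g
  proof -
    let ?y = "\<lambda>n. g / c n + z n"
    have y: "(\<lambda>n. ereal (?y n)) \<longlonglongrightarrow> \<zeta>" by (rule perturbed_tendsto[OF c z])
    show ?thesis
    proof (cases "\<bar>\<zeta>\<bar> = \<infinity>")
      case False
      then obtain b where b: "\<zeta> = ereal b" by auto
      have "(\<lambda>n. real m * (?y n)\<^sup>2) \<longlonglongrightarrow> real m * b\<^sup>2"
        using y unfolding b by (intro tendsto_mult tendsto_const tendsto_power) simp
      then have "(\<lambda>n. cdf (chi_square m) (real m * (?y n)\<^sup>2)) \<longlonglongrightarrow> cdf (chi_square m) (real m * b\<^sup>2)"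
        by (rule isCont_tendsto_compose[rotated])
           (simp add: chi_square.isCont_cdf chi_square_no_atoms[OF m])
      then have "(\<lambda>n. 1 - cdf (chi_square m) (real m * (?y n)\<^sup>2)) \<longlonglongrightarrow> 1 - cdf (chi_square m) (real m * b\<^sup>2)"
        by (intro tendsto_diff tendsto_const)
      moreover have "1 - cdf (chi_square m) (real m * b\<^sup>2) = measure (chi_square m) {x. ereal x > ereal (real m) * \<zeta>\<^sup>2}"
      proof -
        have "{x. ereal x > ereal (real m) * \<zeta>\<^sup>2} = UNIV - {..real m * b\<^sup>2}" unfolding b by auto
        then show ?thesis
          using chi_square.prob_compl[of "{..real m * b\<^sup>2}" m] chi_square.space_eq_univ
          unfolding cdf_def2 by simp
      qed
      ultimately show ?thesis unfolding measure_chi_square_atLeast[OF m] by simp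
    next
      case True
      have "filterlim ?y at_infinity sequentially"
      proof (cases \<zeta>)
        case PInf
        then have "filterlim ?y at_top sequentially" using y by (simp add: tendsto_PInfty_eq_at_top)
        then show ?thesis by (rule filterlim_at_top_imp_at_infinity)
      next
        case MInf
        then have "filterlim ?y at_bot sequentially" using y by (simp add: tendsto_MInfty_eq_at_bot)
        then show ?thesis by (rule filterlim_at_bot_imp_at_infinity)
      next
        case (real r)
        then show ?thesis using True by simp
      qed
      then have "filterlim (\<lambda>n. norm (?y n)) at_top sequentially"
        by (rule filterlim_at_infinity_imp_norm_at_top)
      then have "filterlim (\<lambda>n. (norm (?y n))\<^sup>2) at_top sequentially"
        by (rule filterlim_pow_at_top[rotated]) simp
      then have "filterlim (\<lambda>n. (?y n)\<^sup>2) at_top sequentially"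
        by (simp only: real_norm_def power2_abs)
      then have "filterlim (\<lambda>n. real m * (?y n)\<^sup>2) at_top sequentially"
        by (rule filterlim_tendsto_pos_mult_at_top[OF tendsto_const, rotated]) (use m in simp)
      then have "(\<lambda>n. cdf (chi_square m) (real m * (?y n)\<^sup>2)) \<longlonglongrightarrow> 1"
        by (rule filterlim_compose[OF chi_square.cdf_lim_at_top_prob])
      then have "(\<lambda>n. 1 - cdf (chi_square m) (real m * (?y n)\<^sup>2)) \<longlonglongrightarrow> 1 - 1"
        by (intro tendsto_diff tendsto_const)
      moreover have "ereal (real m) * \<zeta>\<^sup>2 = \<infinity>"
        using True m by (cases \<zeta>) (simp_all add: power2_eq_square)
      then have "{x. ereal x > ereal (real m) * \<zeta>\<^sup>2} = {}" by simp
      ultimately show ?thesis unfolding measure_chi_square_atLeast[OF m] by simp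
    qed
  qed
  from zero_prob_tendsto[OF AE_I2[OF this] borel_measurable_const] show ?thesis
    using std_normal.prob_space by simp
qed

text \<open>For growing degrees of freedom, the limit is governed by the standardised threshold
  \<open>\<surd>(\<nu>/2) (y\<^sup>2 - 1)\<close> at \<open>y = g / c + z\<close>, obtained from \<open>\<nu> y\<^sup>2\<close> by centring at \<open>\<nu>\<close> and scaling by \<open>\<surd>(2 \<nu>)\<close>.\<close>

lemma zero_prob_tendsto_Phi:
  assumes \<nu>: "filterlim \<nu> at_top sequentially"
    and x: "AE g in std_normal_distribution.
      (\<lambda>n. ereal (sqrt (real (\<nu> n) / 2) * ((g / c n + z n)\<^sup>2 - 1))) \<longlonglongrightarrow> x0 g"
    and h [measurable]: "(\<lambda>g. Phi (- x0 g)) \<in> borel_measurable borel"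
  shows "(\<lambda>n. zero_prob (\<nu> n) (c n) (z n)) \<longlonglongrightarrow> (LINT g|std_normal_distribution. Phi (- x0 g))"
proof (rule zero_prob_tendsto[OF _ h])
  have *: "(real m * y - real m) / sqrt (real m * 2) = sqrt (real m / 2) * (y - 1)" for m y
  proof (cases "m = 0")
    case False
    have "sqrt (real m / 2) * sqrt (real m * 2) = sqrt ((real m)\<^sup>2)"
      unfolding real_sqrt_mult[symmetric] by (simp add: power2_eq_square)
    then have "real m * y - real m = sqrt (real m / 2) * (y - 1) * sqrt (real m * 2)"
      by (simp add: algebra_simps)
    moreover have "sqrt (real m * 2) \<noteq> 0" using False by simp
    ultimately show ?thesis by (metis nonzero_divide_eq_eq)
  qed simp
  show "AE g in std_normal_distribution.
      (\<lambda>n. measure (chi_square (\<nu> n)) {real (\<nu> n) * (g / c n + z n)\<^sup>2..}) \<longlonglongrightarrow> Phi (- x0 g)"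
    using x by eventually_elim (rule chi_square_tail_tendsto[OF \<nu>], simp only: *)
qed

lemma sqrt_half_at_top:
  assumes \<nu>: "filterlim \<nu> at_top sequentially"
  shows "filterlim (\<lambda>n. sqrt (real (\<nu> n) / 2)) at_top sequentially"
proof (rule filterlim_compose[OF sqrt_at_top])
  have "filterlim (\<lambda>n. real (\<nu> n)) at_top sequentially"
    by (rule filterlim_compose[OF filterlim_real_sequentially \<nu>])
  from filterlim_tendsto_pos_mult_at_top[OF tendsto_const _ this, of "1 / 2"]
  show "filterlim (\<lambda>n. real (\<nu> n) / 2) at_top sequentially" by simp
qed

lemma zero_prob_inside:
  assumes \<nu>: "filterlim \<nu> at_top sequentially" and c: "filterlim c at_top sequentially"
    and z: "(\<lambda>n. ereal (z n)) \<longlonglongrightarrow> \<zeta>" and \<zeta>: "\<bar>\<zeta>\<bar> < 1"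
  shows "(\<lambda>n. zero_prob (\<nu> n) (c n) (z n)) \<longlonglongrightarrow> 1"
proof -
  obtain b where b: "\<zeta> = ereal b" using \<zeta> by (cases \<zeta>) auto
  then have "\<bar>b\<bar> < 1" using \<zeta> by (simp add: one_ereal_def)
  then have b1: "b\<^sup>2 - 1 < 0" by (simp add: abs_square_less_1)
  have "(\<lambda>n. ereal (sqrt (real (\<nu> n) / 2) * ((g / c n + z n)\<^sup>2 - 1))) \<longlonglongrightarrow> - \<infinity>" for g
  proof -
    have "(\<lambda>n. (g / c n + z n)\<^sup>2 - 1) \<longlonglongrightarrow> b\<^sup>2 - 1"
      using perturbed_tendsto[OF c z, of g] unfolding b by (intro tendsto_diff tendsto_const tendsto_power) simp
    from filterlim_tendsto_neg_mult_at_bot[OF this b1 sqrt_half_at_top[OF \<nu>]]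
    show ?thesis by (simp add: tendsto_MInfty_eq_at_bot mult.commute)
  qed
  from zero_prob_tendsto_Phi[OF \<nu> AE_I2[OF this]] show ?thesis
    by (simp add: std_normal.prob_space[simplified])
qed

lemma zero_prob_outside:
  assumes \<nu>: "filterlim \<nu> at_top sequentially" and c: "filterlim c at_top sequentially"
    and z: "(\<lambda>n. ereal (z n)) \<longlonglongrightarrow> \<zeta>" and \<zeta>: "\<bar>\<zeta>\<bar> > 1"
  shows "(\<lambda>n. zero_prob (\<nu> n) (c n) (z n)) \<longlonglongrightarrow> 0"
proof -
  obtain b where b: "1 < b" "ereal b < \<bar>\<zeta>\<bar>"
    using ereal_dense2[OF \<zeta>] by (auto simp: one_ereal_def)
  have b1: "b\<^sup>2 - 1 > 0" using b(1) by (simp add: one_less_power)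
  have "(\<lambda>n. ereal (sqrt (real (\<nu> n) / 2) * ((g / c n + z n)\<^sup>2 - 1))) \<longlonglongrightarrow> \<infinity>" for g
  proof -
    have "(\<lambda>n. \<bar>ereal (g / c n + z n)\<bar>) \<longlonglongrightarrow> \<bar>\<zeta>\<bar>"
      by (rule tendsto_abs_ereal) (rule perturbed_tendsto[OF c z])
    then have "\<forall>\<^sub>F n in sequentially. ereal b < \<bar>ereal (g / c n + z n)\<bar>"
      by (rule order_tendstoD(1)) (rule b(2))
    moreover have "b\<^sup>2 - 1 \<le> y\<^sup>2 - 1" if "ereal b < \<bar>ereal y\<bar>" for y :: real
      using that b(1) by (simp add: abs_le_square_iff[symmetric])
    ultimately have le: "\<forall>\<^sub>F n in sequentially. sqrt (real (\<nu> n) / 2) * (b\<^sup>2 - 1) \<le> sqrt (real (\<nu> n) / 2) * ((g / c n + z n)\<^sup>2 - 1)"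
      by (auto elim!: eventually_mono intro!: mult_left_mono)
    have "filterlim (\<lambda>n. sqrt (real (\<nu> n) / 2) * (b\<^sup>2 - 1)) at_top sequentially"
      using filterlim_tendsto_pos_mult_at_top[OF tendsto_const b1 sqrt_half_at_top[OF \<nu>]]
      by (simp add: mult.commute)
    from filterlim_at_top_mono[OF this le]
    show ?thesis by (simp add: tendsto_PInfty_eq_at_top)
  qed
  from zero_prob_tendsto_Phi[OF \<nu> AE_I2[OF this]] show ?thesis by simp
qed

text \<open>Factorises \<open>y\<^sup>2 - 1 = (y - 1) (y + 1)\<close> at \<open>y = g / c + z\<close>. Near \<open>y = 1\<close> the second factor contributes the
  constant \<open>\<surd>2\<close>, and the first one compares \<open>g\<close> with \<open>c (1 - z)\<close> on the scale \<open>c / \<surd>\<nu>\<close>.\<close>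

lemma standardised_boundary:
  assumes "0 < \<nu>" "0 < c"
  shows "sqrt (real \<nu> / 2) * ((g / c + z)\<^sup>2 - 1) =
    ((g - c * (1 - z)) * inverse (c / sqrt (real \<nu>))) * ((g / c + z + 1) / sqrt 2)"
proof -
  have y: "(g / c + z)\<^sup>2 - 1 = ((g - c * (1 - z)) / c) * (g / c + z + 1)"
    using assms(2) by (simp add: field_simps power2_eq_square)
  have rearrange: "s / q * (D / c * w) = D * inverse (c / s) * (w / q)" for s q D w :: real
    by (simp add: mult.commute mult.left_commute)
  show ?thesis unfolding y real_sqrt_divide by (rule rearrange)
qed

text \<open>Both sides are the probability that \<open>g \<le> d t + r\<close> for independent standard normal \<open>g\<close> and \<open>t\<close>,
  conditioned on one or the other variable.\<close>

lemma Phi_convolution_swap: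
  assumes d: "0 < d"
  shows "(LINT g|std_normal_distribution. Phi (ereal ((r - g) / d))) = (LINT t|std_normal_distribution. Phi (ereal (d * t + r)))"
proof -
  interpret pair_sigma_finite std_normal_distribution std_normal_distribution ..
  interpret P: pair_prob_space std_normal_distribution std_normal_distribution ..
  define f :: "real \<Rightarrow> real \<Rightarrow> real" where "f g t = indicator {(g, t). g \<le> r - d * t} (g, t)" for g t
  have f1: "f g t = indicator {..(r - g) / d} t" and f2: "f g t = indicator {..r - d * t} g" for g t
    using d by (auto simp: f_def indicator_def field_simps)
  have "integrable (std_normal_distribution \<Otimes>\<^sub>M std_normal_distribution) (case_prod f)"
  proof (rule P.integrable_const_bound[where B = 1])
    show "case_prod f \<in> borel_measurable (std_normal_distribution \<Otimes>\<^sub>M std_normal_distribution)"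
      unfolding f_def by measurable
  qed (auto simp: f_def indicator_def)
  from Fubini_integral[OF this]
  have "(LINT t|std_normal_distribution. LINT g|std_normal_distribution. f g t)
      = (LINT g|std_normal_distribution. LINT t|std_normal_distribution. f g t)" .
  also have "(LINT t|std_normal_distribution. LINT g|std_normal_distribution. f g t)
      = (LINT t|std_normal_distribution. Phi (ereal (r - d * t)))"
    unfolding f2 by (simp add: cdf_def2)
  also have "(LINT g|std_normal_distribution. LINT t|std_normal_distribution. f g t)
      = (LINT g|std_normal_distribution. Phi (ereal ((r - g) / d)))"
    unfolding f1 by (simp add: cdf_def2)
  also have "(LINT t|std_normal_distribution. Phi (ereal (r - d * t))) = (LINT t|std_normal_distribution. Phi (ereal (d * t + r)))"
  proof -
    have "(\<lambda>t. Phi (ereal (d * t + r))) \<in> borel_measurable borel"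
      using d by (intro borel_measurable_mono monoI mono_Phi) simp
    from std_normal_integral_reflect[OF this] show ?thesis by (simp add: algebra_simps)
  qed
  finally show ?thesis ..
qed

lemma Phi_mixing_integral:
  assumes d: "0 < d"
  shows "(LBINT t. Phi (ereal (d * t) + r0) * std_normal_density t) = (LINT t|std_normal_distribution. Phi (ereal (d * t) + r0))"
proof -
  have "(\<lambda>t. Phi (ereal (d * t) + r0)) \<in> borel_measurable borel"
    using d by (intro borel_measurable_mono monoI mono_Phi add_right_mono) simp
  then show ?thesis by (subst integral_density) (auto simp: mult.commute)
qed

text \<open>The boundary case with \<open>\<zeta> = 1\<close>. The quotient \<open>c / \<surd>\<nu>\<close> weighs the fluctuation of the variance estimator
  against that of the least squares estimator.\<close>

context
  fixes \<nu> :: "nat \<Rightarrow> nat" and c z :: "nat \<Rightarrow> real"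
  assumes \<nu>: "filterlim \<nu> at_top sequentially" and c: "filterlim c at_top sequentially"
    and z: "z \<longlonglongrightarrow> 1"
begin

lemma boundary_transform:
  assumes "(\<lambda>n. ereal ((g - c n * (1 - z n)) * inverse (c n / sqrt (real (\<nu> n))))) \<longlonglongrightarrow> x0"
  shows "(\<lambda>n. ereal (sqrt (real (\<nu> n) / 2) * ((g / c n + z n)\<^sup>2 - 1))) \<longlonglongrightarrow> x0 * ereal (sqrt 2)"
proof -
  have "(\<lambda>n. ereal (g / c n + z n)) \<longlonglongrightarrow> ereal 1"
    by (rule perturbed_tendsto[OF c]) (use z in simp)
  then have "(\<lambda>n. (g / c n + z n + 1) / sqrt 2) \<longlonglongrightarrow> (1 + 1) / sqrt 2"
    by (intro tendsto_divide tendsto_add tendsto_const) simp_all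
  also have "(1 + 1) / sqrt 2 = sqrt 2" by (simp add: real_div_sqrt)
  finally have w: "(\<lambda>n. ereal ((g / c n + z n + 1) / sqrt 2)) \<longlonglongrightarrow> ereal (sqrt 2)" by simp
  have "(\<lambda>n. ereal ((g - c n * (1 - z n)) * inverse (c n / sqrt (real (\<nu> n)))) * ereal ((g / c n + z n + 1) / sqrt 2))
      \<longlonglongrightarrow> x0 * ereal (sqrt 2)"
    by (rule tendsto_mult_ereal[OF assms w]) auto
  then have lim: "(\<lambda>n. ereal (((g - c n * (1 - z n)) * inverse (c n / sqrt (real (\<nu> n)))) * ((g / c n + z n + 1) / sqrt 2)))
      \<longlonglongrightarrow> x0 * ereal (sqrt 2)" by simp
  have "\<forall>\<^sub>F n in sequentially. Suc 0 \<le> \<nu> n" "\<forall>\<^sub>F n in sequentially. 0 < c n"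
    using \<nu> c by (auto simp: filterlim_at_top_dense[of c] filterlim_at_top[of \<nu>])
  then have "\<forall>\<^sub>F n in sequentially. ereal (((g - c n * (1 - z n)) * inverse (c n / sqrt (real (\<nu> n)))) * ((g / c n + z n + 1) / sqrt 2))
      = ereal (sqrt (real (\<nu> n) / 2) * ((g / c n + z n)\<^sup>2 - 1))"
    by eventually_elim (simp only: standardised_boundary Suc_le_eq)
  with lim show ?thesis by (rule Lim_transform_eventually)
qed

lemma kappa_pos: "\<forall>\<^sub>F n in sequentially. 0 < c n / sqrt (real (\<nu> n))"
proof -
  have "\<forall>\<^sub>F n in sequentially. Suc 0 \<le> \<nu> n" "\<forall>\<^sub>F n in sequentially. 0 < c n"
    using \<nu> c by (auto simp: filterlim_at_top_dense[of c] filterlim_at_top[of \<nu>])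
  then show ?thesis by eventually_elim simp
qed

text \<open>The fluctuation of the variance estimator is negligible: the standardised threshold is driven to
  \<open>\<infinity>\<close> or \<open>- \<infinity>\<close> according to the sign of \<open>g - r0\<close>, and \<open>g = r0\<close> has probability zero.\<close>

lemma zero_prob_boundary_slow:
  assumes \<kappa>: "(\<lambda>n. c n / sqrt (real (\<nu> n))) \<longlonglongrightarrow> 0"
    and r: "(\<lambda>n. ereal (c n * (1 - z n))) \<longlonglongrightarrow> r0"
  shows "(\<lambda>n. zero_prob (\<nu> n) (c n) (z n)) \<longlonglongrightarrow> Phi r0"
proof -
  define x0 where "x0 g = (if r0 < ereal g then \<infinity> else - \<infinity> :: ereal)" for g
  have inv: "filterlim (\<lambda>n. inverse (c n / sqrt (real (\<nu> n)))) at_top sequentially"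
    by (rule filterlim_inverse_at_top[OF \<kappa> kappa_pos])
  have lim: "(\<lambda>n. ereal (sqrt (real (\<nu> n) / 2) * ((g / c n + z n)\<^sup>2 - 1))) \<longlonglongrightarrow> x0 g"
    if g: "ereal g \<noteq> r0" for g
  proof -
    have inv': "(\<lambda>n. ereal (inverse (c n / sqrt (real (\<nu> n))))) \<longlonglongrightarrow> \<infinity>"
      using inv by (simp add: tendsto_PInfty_eq_at_top)
    have "(\<lambda>n. ereal g - ereal (c n * (1 - z n))) \<longlonglongrightarrow> ereal g - r0"
      by (rule tendsto_diff_ereal_general[OF tendsto_const r]) auto
    from tendsto_mult_ereal[OF this inv'] g
    have "(\<lambda>n. ereal ((g - c n * (1 - z n)) * inverse (c n / sqrt (real (\<nu> n))))) \<longlonglongrightarrow> (ereal g - r0) * \<infinity>"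
      by (cases r0) auto
    from boundary_transform[OF this] show ?thesis
      using g by (cases r0) (auto simp: x0_def)
  qed
  have "AE g in std_normal_distribution. ereal g \<noteq> r0"
  proof (cases r0)
    case (real r)
    then show ?thesis
      using std_normal_no_atoms[of r] std_normal.prob_eq_0[of "{r}"] by simp
  qed auto
  then have "AE g in std_normal_distribution.
      (\<lambda>n. ereal (sqrt (real (\<nu> n) / 2) * ((g / c n + z n)\<^sup>2 - 1))) \<longlonglongrightarrow> x0 g"
    by eventually_elim (rule lim)
  moreover have eq: "Phi (- x0 g) = indicator {g. ereal g \<le> r0} g" for g
    by (auto simp: x0_def indicator_def)
  ultimately have "(\<lambda>n. zero_prob (\<nu> n) (c n) (z n)) \<longlonglongrightarrow> (LINT g|std_normal_distribution. Phi (- x0 g))"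
    by (intro zero_prob_tendsto_Phi[OF \<nu>]) (simp_all add: eq)
  then show ?thesis unfolding eq by (simp add: Phi_measure)
qed

text \<open>Both sources of randomness survive: the standardised threshold tends to \<open>(g - r0) / d\<close>, and averaging the
  resulting normal tail over \<open>g\<close> is a convolution of two normal laws.\<close>

lemma zero_prob_boundary_balanced:
  assumes d: "0 < d" and \<kappa>: "(\<lambda>n. c n / sqrt (real (\<nu> n))) \<longlonglongrightarrow> sqrt 2 * d"
    and r: "(\<lambda>n. ereal (c n * (1 - z n))) \<longlonglongrightarrow> r0"
  shows "(\<lambda>n. zero_prob (\<nu> n) (c n) (z n)) \<longlonglongrightarrow> (LBINT t. Phi (ereal (d * t) + r0) * std_normal_density t)"
proof -
  define x0 where "x0 g = (ereal g - r0) * ereal (inverse (sqrt 2 * d)) * ereal (sqrt 2)" for g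
  have lim: "(\<lambda>n. ereal (sqrt (real (\<nu> n) / 2) * ((g / c n + z n)\<^sup>2 - 1))) \<longlonglongrightarrow> x0 g" for g
    unfolding x0_def
  proof (rule boundary_transform)
    have "(\<lambda>n. ereal (inverse (c n / sqrt (real (\<nu> n))))) \<longlonglongrightarrow> ereal (inverse (sqrt 2 * d))"
      using tendsto_inverse[OF \<kappa>] d by simp
    moreover have "(\<lambda>n. ereal g - ereal (c n * (1 - z n))) \<longlonglongrightarrow> ereal g - r0"
      by (rule tendsto_diff_ereal_general[OF tendsto_const r]) auto
    ultimately have "(\<lambda>n. (ereal g - ereal (c n * (1 - z n))) * ereal (inverse (c n / sqrt (real (\<nu> n)))))
        \<longlonglongrightarrow> (ereal g - r0) * ereal (inverse (sqrt 2 * d))"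
      using d by (intro tendsto_mult_ereal) auto
    then show "(\<lambda>n. ereal ((g - c n * (1 - z n)) * inverse (c n / sqrt (real (\<nu> n)))))
        \<longlonglongrightarrow> (ereal g - r0) * ereal (inverse (sqrt 2 * d))" by simp
  qed
  show ?thesis
  proof (cases r0)
    case (real r)
    have eq: "- x0 g = ereal ((r - g) / d)" for g
      unfolding x0_def real using d by (simp add: field_simps)
    have "(\<lambda>g. - Phi (- x0 g)) \<in> borel_measurable borel"
      unfolding eq using d by (intro borel_measurable_mono monoI le_imp_neg_le mono_Phi) (simp add: divide_right_mono)
    then have "(\<lambda>g. Phi (- x0 g)) \<in> borel_measurable borel" by (simp only: borel_measurable_uminus_eq)
    from zero_prob_tendsto_Phi[OF \<nu> AE_I2[OF lim] this] show ?thesis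
      unfolding eq Phi_convolution_swap[OF d] Phi_mixing_integral[OF d] by (simp add: real)
  next
    case PInf
    then have "- x0 g = \<infinity>" for g unfolding x0_def using d by simp
    with zero_prob_tendsto_Phi[OF \<nu> AE_I2[OF lim]] show ?thesis
      unfolding Phi_mixing_integral[OF d] using std_normal.prob_space by (simp add: PInf)
  next
    case MInf
    then have "- x0 g = - \<infinity>" for g unfolding x0_def using d by simp
    with zero_prob_tendsto_Phi[OF \<nu> AE_I2[OF lim]] show ?thesis
      unfolding Phi_mixing_integral[OF d] by (simp add: MInf)
  qed
qed

text \<open>The fluctuation of the variance estimator dominates: after division by \<open>c / \<surd>\<nu>\<close> the value \<open>g\<close> disappears
  and the standardised threshold tends to \<open>- r'\<close> for every \<open>g\<close>.\<close>

lemma zero_prob_boundary_fast: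
  assumes \<kappa>: "filterlim (\<lambda>n. c n / sqrt (real (\<nu> n))) at_top sequentially"
    and r: "(\<lambda>n. ereal (inverse (c n / sqrt (real (\<nu> n))) * (c n * (1 - z n)))) \<longlonglongrightarrow> ereal (inverse (sqrt 2)) * r'"
  shows "(\<lambda>n. zero_prob (\<nu> n) (c n) (z n)) \<longlonglongrightarrow> Phi r'"
proof -
  have eq: "ereal (g * i) - ereal (i * w) = ereal ((g - w) * i)" for g i w :: real
    by (simp add: algebra_simps)
  define x0 where "x0 = (ereal 0 - ereal (inverse (sqrt 2)) * r') * ereal (sqrt 2)"
  have "(\<lambda>n. ereal (sqrt (real (\<nu> n) / 2) * ((g / c n + z n)\<^sup>2 - 1))) \<longlonglongrightarrow> x0" for g
    unfolding x0_def
  proof (rule boundary_transform)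
    have "(\<lambda>n. inverse (c n / sqrt (real (\<nu> n)))) \<longlonglongrightarrow> 0"
      by (rule tendsto_inverse_0_at_top[OF \<kappa>])
    then have "(\<lambda>n. g * inverse (c n / sqrt (real (\<nu> n)))) \<longlonglongrightarrow> 0" by (rule tendsto_mult_right_zero)
    then have "(\<lambda>n. ereal (g * inverse (c n / sqrt (real (\<nu> n))))) \<longlonglongrightarrow> ereal 0" by (simp only: tendsto_ereal)
    then have "(\<lambda>n. ereal (g * inverse (c n / sqrt (real (\<nu> n)))) - ereal (inverse (c n / sqrt (real (\<nu> n))) * (c n * (1 - z n))))
        \<longlonglongrightarrow> ereal 0 - ereal (inverse (sqrt 2)) * r'"
      by (rule tendsto_diff_ereal_general[OF _ r]) auto
    then show "(\<lambda>n. ereal ((g - c n * (1 - z n)) * inverse (c n / sqrt (real (\<nu> n)))))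
        \<longlonglongrightarrow> ereal 0 - ereal (inverse (sqrt 2)) * r'"
      unfolding eq .
  qed
  moreover have "x0 = - r'"
    unfolding x0_def by (cases r') auto
  ultimately show ?thesis
    using zero_prob_tendsto_Phi[OF \<nu>, of c z "\<lambda>_. - r'"] std_normal.prob_space by simp
qed

end

section \<open>Pivots of the regression model\<close>

text \<open>The pivots are the projections of the errors on the unit vector in direction \<open>w\<close> and, for \<open>Q\<close>, on the
  \<open>b j\<close> of \<open>least_squares_decomposition\<close>; index \<open>\<nu>\<close> of the orthonormal family \<open>q\<close> is reserved for \<open>w\<close>.\<close>

lemma (in prob_space) regression_pivots:
  fixes X :: "real mat" and u Y :: "'a \<Rightarrow> real vec"
  assumes X: "X \<in> carrier_mat n k" and rank: "vec_space.rank n X = k" and kn: "k < n" and i: "i < k"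
    and \<theta>: "\<theta> \<in> carrier_vec k" and \<sigma>: "0 < \<sigma>" and u: "gaussian_errors M n \<sigma> u"
    and Y: "\<And>\<omega>. \<omega> \<in> space M \<Longrightarrow> Y \<omega> = X *\<^sub>v \<theta> + u \<omega>"
  obtains G Q where
    "G \<in> borel_measurable M" "Q \<in> borel_measurable M"
    "distr M (borel \<Otimes>\<^sub>M borel) (\<lambda>\<omega>. (G \<omega>, Q \<omega>)) = std_normal_distribution \<Otimes>\<^sub>M chi_square (n - k)"
    "0 < xi X (Suc i)"
    "\<And>\<omega>. \<omega> \<in> space M \<Longrightarrow> theta_LS X (Y \<omega>) $ i = \<theta> $ i + \<sigma> * xi X (Suc i) / sqrt (real n) * G \<omega>"
    "\<And>\<omega>. \<omega> \<in> space M \<Longrightarrow> sigma_hat X (Y \<omega>) = \<sigma> * sqrt (Q \<omega> / real (n - k))"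
proof -
  obtain b w where b: "\<And>j. j < n - k \<Longrightarrow> b j \<in> carrier_vec n"
    and bb: "\<And>j l. j < n - k \<Longrightarrow> l < n - k \<Longrightarrow> b j \<bullet> b l = (if j = l then 1 else 0)"
    and w: "w \<in> carrier_vec n" and ww: "w \<bullet> w > 0" and wb: "\<And>j. j < n - k \<Longrightarrow> w \<bullet> b j = 0"
    and xi: "xi X (Suc i) = sqrt (real n) * sqrt (w \<bullet> w)"
    and LS: "\<And>\<theta> u. \<theta> \<in> carrier_vec k \<Longrightarrow> u \<in> carrier_vec n \<Longrightarrow>
       theta_LS X (X *\<^sub>v \<theta> + u) $ i = \<theta> $ i + w \<bullet> u"
    and RSS: "\<And>\<theta> u. \<theta> \<in> carrier_vec k \<Longrightarrow> u \<in> carrier_vec n \<Longrightarrow>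
       (X *\<^sub>v \<theta> + u - X *\<^sub>v theta_LS X (X *\<^sub>v \<theta> + u)) \<bullet> (X *\<^sub>v \<theta> + u - X *\<^sub>v theta_LS X (X *\<^sub>v \<theta> + u))
         = (\<Sum>j<n - k. (b j \<bullet> u)\<^sup>2)"
    using least_squares_decomposition[OF X rank less_imp_le[OF kn] i] by blast
  define \<nu> where "\<nu> = n - k"
  define q where "q j = (if j < \<nu> then b j else (1 / sqrt (w \<bullet> w)) \<cdot>\<^sub>v w)" for j
  have carr: "u \<omega> \<in> carrier_vec n" if "\<omega> \<in> space M" for \<omega>
    using u that unfolding gaussian_errors_def by auto
  have q: "q j \<in> carrier_vec n" for j using b w by (auto simp: q_def \<nu>_def)
  have bw: "b j \<bullet> w = 0" if "j < n - k" for j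
    using wb[OF that] comm_scalar_prod[OF w b[OF that]] by simp
  have orth: "q j \<bullet> q l = (if j = l then 1 else 0)" if "j \<in> {..<Suc \<nu>}" "l \<in> {..<Suc \<nu>}" for j l
    using that b bb w ww wb bw by (auto simp: q_def \<nu>_def less_Suc_eq)
  define Z where "Z \<omega> = (\<lambda>j\<in>{..<Suc \<nu>}. (q j \<bullet> u \<omega>) / \<sigma>)" for \<omega>
  have law: "distr M (PiM {..<Suc \<nu>} (\<lambda>_. borel)) Z = PiM {..<Suc \<nu>} (\<lambda>_. std_normal_distribution)"
    unfolding Z_def by (rule orthonormal_gaussian_projections[OF u \<sigma> _ q orth]) auto
  have Z [measurable]: "Z \<in> measurable M (PiM {..<Suc \<nu>} (\<lambda>_. borel))"
    unfolding Z_def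
    by (intro measurable_restrict borel_measurable_divide borel_measurable_const
        gaussian_errors_scalar_prod_measurable[OF u])
  define f where "f x = (x \<nu>, \<Sum>j<\<nu>. (x j)\<^sup>2)" for x :: "nat \<Rightarrow> real"
  have f [measurable]: "f \<in> measurable (PiM {..<Suc \<nu>} (\<lambda>_. borel)) (borel \<Otimes>\<^sub>M borel)"
    unfolding f_def by (intro measurable_Pair borel_measurable_sum borel_measurable_power) auto
  define G where "G \<omega> = fst (f (Z \<omega>))" for \<omega>
  define Q where "Q \<omega> = snd (f (Z \<omega>))" for \<omega>
  have fZ: "(\<lambda>\<omega>. f (Z \<omega>)) \<in> measurable M (borel \<Otimes>\<^sub>M borel)" by measurable
  show thesis
  proof (rule that[of G Q])
    show "G \<in> borel_measurable M" "Q \<in> borel_measurable M"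
      unfolding G_def Q_def using fZ by measurable
    have "distr M (borel \<Otimes>\<^sub>M borel) (\<lambda>\<omega>. (G \<omega>, Q \<omega>)) = distr (distr M (PiM {..<Suc \<nu>} (\<lambda>_. borel)) Z) (borel \<Otimes>\<^sub>M borel) f"
      by (subst distr_distr[OF f Z]) (simp add: G_def Q_def comp_def)
    also have "\<dots> = std_normal_distribution \<Otimes>\<^sub>M chi_square (n - k)"
      unfolding law f_def law_coordinate_sum_squares by (simp add: \<nu>_def)
    finally show "distr M (borel \<Otimes>\<^sub>M borel) (\<lambda>\<omega>. (G \<omega>, Q \<omega>)) = std_normal_distribution \<Otimes>\<^sub>M chi_square (n - k)" .
    show "0 < xi X (Suc i)" unfolding xi using ww kn by simp
    fix \<omega> assume \<omega>: "\<omega> \<in> space M"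
    have G: "G \<omega> = (w \<bullet> u \<omega>) / (sqrt (w \<bullet> w) * \<sigma>)"
      using w carr[OF \<omega>] by (simp add: G_def f_def Z_def q_def)
    show "theta_LS X (Y \<omega>) $ i = \<theta> $ i + \<sigma> * xi X (Suc i) / sqrt (real n) * G \<omega>"
      unfolding Y[OF \<omega>] LS[OF \<theta> carr[OF \<omega>]] xi G using ww \<sigma> kn by simp
    have Q: "Q \<omega> = (\<Sum>j<n - k. (b j \<bullet> u \<omega>)\<^sup>2) / \<sigma>\<^sup>2"
      by (simp add: Q_def f_def Z_def q_def \<nu>_def power_divide sum_divide_distrib)
    have "sigma_hat X (Y \<omega>) = sqrt ((\<Sum>j<n - k. (b j \<bullet> u \<omega>)\<^sup>2) / real (n - k))"
      using X unfolding sigma_hat_def Y[OF \<omega>] RSS[OF \<theta> carr[OF \<omega>]] by simp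
    also have "\<dots> = sqrt (\<sigma>\<^sup>2 * (Q \<omega> / real (n - k)))"
      unfolding Q using \<sigma> by simp
    also have "\<dots> = \<sigma> * sqrt (Q \<omega> / real (n - k))"
      using \<sigma> by (simp add: real_sqrt_mult del: times_divide_eq_right)
    finally show "sigma_hat X (Y \<omega>) = \<sigma> * sqrt (Q \<omega> / real (n - k))" .
  qed
qed

section \<open>Weak convergence to two-point mixtures\<close>

lemma sets_pointmass [simp]: "sets (pointmass z) = sets borel"
  by (simp add: pointmass_def)

lemma finite_measure_pointmass: "finite_measure (pointmass z)"
  by (rule finite_measureI) (simp add: pointmass_def)

lemma measure_pointmass:
  assumes "A \<in> sets borel"
  shows "measure (pointmass z) A = (if \<bar>z\<bar> = \<infinity> then 0 else indicator A (real_of_ereal z))"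
  using assms by (simp add: pointmass_def measure_return)

lemma emeasure_mixture_pointmass:
  assumes a: "0 \<le> a" and b: "0 \<le> b" and A: "A \<in> sets borel"
  shows "emeasure (mixture a (pointmass z) b (pointmass z')) A =
    ennreal (a * measure (pointmass z) A + b * measure (pointmass z') A)"
  unfolding emeasure_mixture[OF sets_pointmass sets_pointmass A]
  using a b by (simp add: finite_measure.emeasure_eq_measure[OF finite_measure_pointmass] ennreal_mult ennreal_plus)

lemma measure_mixture_pointmass:
  assumes "0 \<le> a" "0 \<le> b" "A \<in> sets borel"
  shows "measure (mixture a (pointmass z) b (pointmass z')) A =
    a * measure (pointmass z) A + b * measure (pointmass z') A"
  by (rule measure_eq_emeasure_eq_ennreal[OF _ emeasure_mixture_pointmass[OF assms]])
     (use assms in simp)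

lemma mixture_one_zero: "mixture 1 (pointmass z) 0 (pointmass z') = pointmass z"
  by (rule measure_eqI) (simp_all add: emeasure_mixture)

lemma mixture_zero_one: "mixture 0 (pointmass z) 1 (pointmass z') = pointmass z'"
  by (rule measure_eqI) (simp_all add: emeasure_mixture)

text \<open>A variable that equals \<open>- z n\<close> on \<open>K n\<close> and a negligible \<open>U n\<close> elsewhere converges to a two-point
  mixture with weight \<open>lim P(K n)\<close> at \<open>- \<zeta>\<close>. At a continuity point \<open>x\<close> of the limit, either \<open>x\<close> differs from
  an atom or that atom has weight zero; this is exactly what is needed to pass to the limit in
  the contributions \<open>A\<close> of \<open>K n\<close> and \<open>B\<close> of its complement. If \<open>\<zeta>\<close> is infinite, the
  hypothesis \<open>w = 0\<close> prevents a loss of mass.\<close>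

lemma weak_conv_two_point:
  fixes M :: "nat \<Rightarrow> 'w measure" and U :: "nat \<Rightarrow> 'w \<Rightarrow> real" and K :: "nat \<Rightarrow> 'w set" and z :: "nat \<Rightarrow> real"
  assumes P: "\<forall>\<^sub>F n in sequentially. prob_space (M n) \<and> K n \<in> sets (M n) \<and> U n \<in> borel_measurable (M n)"
    and small: "\<And>\<epsilon>. 0 < \<epsilon> \<Longrightarrow> (\<lambda>n. measure (M n) {\<omega> \<in> space (M n). \<epsilon> < \<bar>U n \<omega>\<bar>}) \<longlonglongrightarrow> 0"
    and K: "(\<lambda>n. measure (M n) (K n)) \<longlonglongrightarrow> w"
    and z: "(\<lambda>n. ereal (z n)) \<longlonglongrightarrow> \<zeta>" and inf: "\<bar>\<zeta>\<bar> = \<infinity> \<Longrightarrow> w = 0"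
    and H: "\<forall>\<^sub>F n in sequentially. \<forall>x. H n x = measure (M n) {\<omega> \<in> space (M n). (if \<omega> \<in> K n then - z n else U n \<omega>) \<le> x}"
  shows "weak_conv H (cdf (mixture w (pointmass (- \<zeta>)) (1 - w) (pointmass 0)))"
  unfolding weak_conv_def
proof (intro allI impI)
  define p where "p n = measure (M n) (K n)" for n
  have p: "p \<longlonglongrightarrow> w" using K unfolding p_def .
  have "\<forall>\<^sub>F n in sequentially. 0 \<le> p n \<and> p n \<le> 1"
    using P by eventually_elim (auto simp: p_def intro: prob_space.prob_le_1)
  then have w0: "0 \<le> w" and w1: "w \<le> 1"
    by (auto intro: tendsto_lowerbound[OF p] tendsto_upperbound[OF p] elim: eventually_mono)
  define D where "D = mixture w (pointmass (- \<zeta>)) (1 - w) (pointmass 0)"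
  have meas: "measure D A = w * measure (pointmass (- \<zeta>)) A + (1 - w) * indicator A 0" if "A \<in> sets borel" for A
    unfolding D_def using w0 w1 that by (subst measure_mixture_pointmass) (auto simp: measure_pointmass)
  have sets_D: "sets D = sets borel" unfolding D_def by simp
  have "emeasure D (space D) \<noteq> \<infinity>"
    unfolding D_def using w0 w1 sets_eq_imp_space_eq[OF sets_mixture]
    by (subst emeasure_mixture_pointmass) auto
  then have "finite_measure D" by (rule finite_measureI)
  then interpret D: finite_borel_measure D
    using sets_D by (simp add: finite_borel_measure_def finite_borel_measure_axioms_def)
  fix x assume "isCont (cdf (mixture w (pointmass (- \<zeta>)) (1 - w) (pointmass 0))) x"
  then have "measure D {x} = 0" using D.isCont_cdf[of x] unfolding D_def[symmetric] by simp
  moreover have "0 \<le> w * measure (pointmass (- \<zeta>)) {x}" "0 \<le> (1 - w) * indicator {x} (0 :: real)"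
    using w0 w1 by auto
  ultimately have "w * measure (pointmass (- \<zeta>)) {x} = 0 \<and> (1 - w) * indicator {x} (0 :: real) = 0"
    using meas[of "{x}"] by (simp only: add_nonneg_eq_0_iff[symmetric] borel_singleton sets.empty_sets)
  then have c1: "w = 0 \<or> (\<exists>b. \<zeta> = ereal b \<and> - b \<noteq> x)" and c2: "w = 1 \<or> x \<noteq> 0"
    using inf by (auto simp: measure_pointmass indicator_def split: if_splits)
  define A where "A n = p n * (if - z n \<le> x then 1 else 0)" for n
  define B where "B n = measure (M n) {\<omega> \<in> space (M n). \<omega> \<notin> K n \<and> U n \<omega> \<le> x}" for n
  have A: "A \<longlonglongrightarrow> w * measure (pointmass (- \<zeta>)) {..x}"
  proof (cases "w = 0")
    case True
    have "A \<longlonglongrightarrow> 0"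
      by (rule Lim_null_comparison[of _ p]) (use p True in \<open>auto simp: A_def p_def\<close>)
    then show ?thesis using True by simp
  next
    case False
    then obtain b where b: "\<zeta> = ereal b" "- b \<noteq> x" using c1 by auto
    have zb: "(\<lambda>n. - z n) \<longlonglongrightarrow> - b" using z unfolding b by (intro tendsto_minus) simp
    have "\<forall>\<^sub>F n in sequentially. (- z n \<le> x) = (- b \<le> x)"
    proof (cases "- b < x")
      case True
      from order_tendstoD(2)[OF zb this] show ?thesis by eventually_elim (use True in auto)
    next
      case False
      then have "x < - b" using b by simp
      from order_tendstoD(1)[OF zb this] show ?thesis by eventually_elim (use \<open>x < - b\<close> in auto)
    qed
    then have "\<forall>\<^sub>F n in sequentially. p n * measure (pointmass (- \<zeta>)) {..x} = A n"
      by eventually_elim (auto simp: A_def b measure_pointmass)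
    with tendsto_mult_right[OF p, of "measure (pointmass (- \<zeta>)) {..x}"] show ?thesis
      by (rule Lim_transform_eventually)
  qed
  have B_bounds: "\<forall>\<^sub>F n in sequentially. 0 \<le> B n \<and> B n \<le> 1 - p n"
    using P
  proof eventually_elim
    case (elim n)
    then interpret prob_space "M n" by simp
    have [measurable]: "K n \<in> sets (M n)" "U n \<in> borel_measurable (M n)" using elim by auto
    have "B n \<le> prob (space (M n) - K n)"
      unfolding B_def by (rule finite_measure_mono) auto
    then show ?case using prob_compl[of "K n"] by (simp add: B_def p_def)
  qed
  have B: "B \<longlonglongrightarrow> (1 - w) * indicator {..x} (0 :: real)"
  proof -
    \<comment> \<open>The value \<open>x = 0\<close> is a continuity point only if the atom at 0 is absent.\<close>
    consider "w = 1" | "x < 0" | "0 < x" using c2 by linarith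
    then show ?thesis
    proof cases
      case 1
      have "B \<longlonglongrightarrow> 0"
        by (rule tendsto_sandwich[OF _ _ tendsto_const, of _ _ _ "\<lambda>n. 1 - p n"])
           (use B_bounds tendsto_diff[OF tendsto_const p, of 1] 1 in \<open>auto elim: eventually_mono\<close>)
      then show ?thesis using 1 by simp
    next
      case 2
      have "\<forall>\<^sub>F n in sequentially. B n \<le> measure (M n) {\<omega> \<in> space (M n). - x / 2 < \<bar>U n \<omega>\<bar>}"
        using P
      proof eventually_elim
        case (elim n)
        then interpret prob_space "M n" by simp
        have [measurable]: "K n \<in> sets (M n)" "U n \<in> borel_measurable (M n)" using elim by auto
        show ?case unfolding B_def by (rule finite_measure_mono) (use 2 in auto)
      qed
      then have "B \<longlonglongrightarrow> 0"
        by (intro tendsto_sandwich[OF _ _ tendsto_const small[of "- x / 2"]])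
           (use B_bounds 2 in \<open>auto elim: eventually_mono\<close>)
      then show ?thesis using 2 by simp
    next
      case 3
      have "\<forall>\<^sub>F n in sequentially. 1 - p n - measure (M n) {\<omega> \<in> space (M n). x / 2 < \<bar>U n \<omega>\<bar>} \<le> B n"
        using P
      proof eventually_elim
        case (elim n)
        then interpret prob_space "M n" by simp
        have [measurable]: "K n \<in> sets (M n)" "U n \<in> borel_measurable (M n)" using elim by auto
        have "prob (space (M n) - K n) \<le> prob ({\<omega> \<in> space (M n). \<omega> \<notin> K n \<and> U n \<omega> \<le> x} \<union> {\<omega> \<in> space (M n). x / 2 < \<bar>U n \<omega>\<bar>})"
          by (rule finite_measure_mono) (use 3 in auto)
        also have "\<dots> \<le> B n + prob {\<omega> \<in> space (M n). x / 2 < \<bar>U n \<omega>\<bar>}"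
          unfolding B_def by (rule measure_Un_le) measurable
        finally show ?case using prob_compl[of "K n"] by (simp add: p_def)
      qed
      moreover have "(\<lambda>n. 1 - p n - measure (M n) {\<omega> \<in> space (M n). x / 2 < \<bar>U n \<omega>\<bar>}) \<longlonglongrightarrow> 1 - w - 0"
        by (intro tendsto_diff tendsto_const p small) (use 3 in simp)
      moreover have "(\<lambda>n. 1 - p n) \<longlonglongrightarrow> 1 - w"
        by (intro tendsto_diff tendsto_const p)
      ultimately have "B \<longlonglongrightarrow> 1 - w"
        using B_bounds by (intro tendsto_sandwich[of _ B _ "\<lambda>n. 1 - p n"]) (auto elim: eventually_mono)
      then show ?thesis using 3 by simp
    qed
  qed
  have "\<forall>\<^sub>F n in sequentially. A n + B n = H n x"
    using P H
  proof eventually_elim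
    case (elim n)
    then interpret prob_space "M n" by simp
    have [measurable]: "K n \<in> sets (M n)" "U n \<in> borel_measurable (M n)" using elim by auto
    have sub: "K n \<subseteq> space (M n)" by (rule sets.sets_into_space) simp
    have "H n x = prob ((if - z n \<le> x then K n else {}) \<union> {\<omega> \<in> space (M n). \<omega> \<notin> K n \<and> U n \<omega> \<le> x})"
      using elim sub by (auto intro!: arg_cong[where f = prob])
    also have "\<dots> = prob (if - z n \<le> x then K n else {}) + B n"
      unfolding B_def by (rule finite_measure_Union) auto
    finally show ?case by (simp add: A_def p_def)
  qed
  with tendsto_add[OF A B] have "(\<lambda>n. H n x) \<longlonglongrightarrow> w * measure (pointmass (- \<zeta>)) {..x} + (1 - w) * indicator {..x} 0"
    by (rule Lim_transform_eventually)
  then show "(\<lambda>n. H n x) \<longlonglongrightarrow> cdf (mixture w (pointmass (- \<zeta>)) (1 - w) (pointmass 0)) x"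
    unfolding D_def[symmetric] cdf_def2 using meas[of "{..x}"] by simp
qed

text \<open>Dividing by \<open>s = \<sigma> \<xi> \<eta>\<close> turns the least squares estimate into \<open>U + z\<close> and the threshold into
  \<open>\<surd>(Q / (n - k))\<close>.\<close>

lemma (in prob_space) hard_threshold_representation:
  fixes X :: "real mat" and u Y :: "'a \<Rightarrow> real vec" and \<eta> :: real
  assumes X: "X \<in> carrier_mat n k" and rank: "vec_space.rank n X = k" and kn: "k < n"
    and i: "1 \<le> i" "i \<le> k"
    and \<theta>: "\<theta> \<in> carrier_vec k" and \<sigma>: "0 < \<sigma>" and u: "gaussian_errors M n \<sigma> u"
    and Y: "\<And>\<omega>. \<omega> \<in> space M \<Longrightarrow> Y \<omega> = X *\<^sub>v \<theta> + u \<omega>" and \<eta>: "0 < \<eta>"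
  defines "c \<equiv> sqrt (real n) * \<eta>" and "z \<equiv> \<theta> $ (i - 1) / (\<sigma> * xi X i * \<eta>)"
  obtains K U where "K \<in> sets M" "U \<in> borel_measurable M"
    "\<And>\<epsilon>. measure M {\<omega> \<in> space M. \<epsilon> < \<bar>U \<omega>\<bar>} = measure std_normal_distribution {g. \<epsilon> < \<bar>g / c\<bar>}"
    "measure M K = zero_prob (n - k) c z"
    "\<And>x. cdf (distr M borel (\<lambda>\<omega>. inverse \<sigma> * inverse (xi X i * \<eta>) * (theta_H X \<eta> i (Y \<omega>) - \<theta> $ (i - 1)))) x
       = measure M {\<omega> \<in> space M. (if \<omega> \<in> K then - z else U \<omega>) \<le> x}"
proof -
  have i': "i - 1 < k" "Suc (i - 1) = i" using i by auto
  obtain G Q where G [measurable]: "G \<in> borel_measurable M" and Q [measurable]: "Q \<in> borel_measurable M"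
    and law: "distr M (borel \<Otimes>\<^sub>M borel) (\<lambda>\<omega>. (G \<omega>, Q \<omega>)) = std_normal_distribution \<Otimes>\<^sub>M chi_square (n - k)"
    and xi: "0 < xi X i"
    and LS: "\<And>\<omega>. \<omega> \<in> space M \<Longrightarrow> theta_LS X (Y \<omega>) $ (i - 1) = \<theta> $ (i - 1) + \<sigma> * xi X i / sqrt (real n) * G \<omega>"
    and S: "\<And>\<omega>. \<omega> \<in> space M \<Longrightarrow> sigma_hat X (Y \<omega>) = \<sigma> * sqrt (Q \<omega> / real (n - k))"
    using regression_pivots[OF X rank kn i'(1) \<theta> \<sigma> u Y] unfolding i'(2) by blast
  have c: "0 < c" unfolding c_def using kn \<eta> by simp
  interpret PP: pair_prob_space std_normal_distribution "chi_square (n - k)" ..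
  define U where "U \<omega> = G \<omega> / c" for \<omega>
  define K where "K = {\<omega> \<in> space M. \<bar>U \<omega> + z\<bar> \<le> sqrt (Q \<omega> / real (n - k))}"
  have U [measurable]: "U \<in> borel_measurable M" unfolding U_def by measurable
  have K [measurable]: "K \<in> sets M" unfolding K_def by measurable
  have pair: "measure M {\<omega> \<in> space M. (G \<omega>, Q \<omega>) \<in> E} = measure (std_normal_distribution \<Otimes>\<^sub>M chi_square (n - k)) E"
    if E: "E \<in> sets (borel \<Otimes>\<^sub>M borel)" for E
    unfolding law[symmetric] by (subst measure_distr[OF _ E]) (auto intro!: arg_cong[where f = "measure M"])
  have fst_law: "distr M borel G = std_normal_distribution"
  proof -
    have "distr M borel G = distr (distr M (borel \<Otimes>\<^sub>M borel) (\<lambda>\<omega>. (G \<omega>, Q \<omega>))) borel fst"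
      by (subst distr_distr) (auto simp: comp_def)
    also have "\<dots> = distr (std_normal_distribution \<Otimes>\<^sub>M chi_square (n - k)) std_normal_distribution fst"
      unfolding law by (rule distr_cong) auto
    also have "\<dots> = std_normal_distribution"
      by (rule chi_square.distr_pair_fst)
    finally show ?thesis .
  qed
  have sqrt_iff: "\<bar>g / c + z\<bar> \<le> sqrt (q / real (n - k)) \<longleftrightarrow> real (n - k) * (g / c + z)\<^sup>2 \<le> q" for g q
  proof -
    have "\<bar>g / c + z\<bar> \<le> sqrt (q / real (n - k)) \<longleftrightarrow> sqrt ((g / c + z)\<^sup>2) \<le> sqrt (q / real (n - k))"
      by simp
    also have "\<dots> \<longleftrightarrow> (g / c + z)\<^sup>2 \<le> q / real (n - k)" by (rule real_sqrt_le_iff)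
    also have "\<dots> \<longleftrightarrow> real (n - k) * (g / c + z)\<^sup>2 \<le> q"
      using kn by (simp add: pos_le_divide_eq mult.commute)
    finally show ?thesis .
  qed
  show thesis
  proof (rule that[OF K U])
    show "measure M {\<omega> \<in> space M. \<epsilon> < \<bar>U \<omega>\<bar>} = measure std_normal_distribution {g. \<epsilon> < \<bar>g / c\<bar>}" for \<epsilon>
      unfolding fst_law[symmetric] U_def
      by (subst measure_distr) (auto intro!: arg_cong[where f = "measure M"])
    define E where "E = {p. real (n - k) * (fst p / c + z)\<^sup>2 \<le> snd p}"
    have "{p \<in> space (borel \<Otimes>\<^sub>M borel). real (n - k) * (fst p / c + z)\<^sup>2 \<le> snd p} \<in> sets (borel \<Otimes>\<^sub>M borel)"
      by measurable
    then have E [measurable]: "E \<in> sets (borel \<Otimes>\<^sub>M borel)" by (simp add: E_def space_pair_measure)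
    have E' [measurable]: "E \<in> sets (std_normal_distribution \<Otimes>\<^sub>M chi_square (n - k))"
      using E by (simp cong: sets_pair_measure_cong)
    have "measure M K = measure M {\<omega> \<in> space M. (G \<omega>, Q \<omega>) \<in> E}"
      by (simp add: K_def U_def sqrt_iff E_def)
    also have "\<dots> = measure (std_normal_distribution \<Otimes>\<^sub>M chi_square (n - k)) E"
      by (rule pair[OF E])
    also have "\<dots> = (LINT p|(std_normal_distribution \<Otimes>\<^sub>M chi_square (n - k)). indicator E p)"
      by (simp add: space_pair_measure)
    also have "\<dots> = (LINT g|std_normal_distribution. LINT q|chi_square (n - k). indicator E (g, q))"
      by (rule PP.integral_fst'[symmetric]) (rule PP.integrable_const_bound[where B = 1], auto simp: indicator_def)
    also have "\<dots> = zero_prob (n - k) c z"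
      unfolding zero_prob_def
    proof (rule Bochner_Integration.integral_cong[OF refl])
      fix g
      have "(LINT q|chi_square (n - k). indicator E (g, q)) = (LINT q|chi_square (n - k). indicator {real (n - k) * (g / c + z)\<^sup>2..} q :: real)"
        by (rule Bochner_Integration.integral_cong) (auto simp: E_def indicator_def)
      then show "(LINT q|chi_square (n - k). indicator E (g, q)) = measure (chi_square (n - k)) {real (n - k) * (g / c + z)\<^sup>2..}"
        using chi_square.space_eq_univ by simp
    qed
    finally show "measure M K = zero_prob (n - k) c z" .
    fix x
    have Z: "inverse \<sigma> * inverse (xi X i * \<eta>) * (theta_H X \<eta> i (Y \<omega>) - \<theta> $ (i - 1)) = (if \<omega> \<in> K then - z else U \<omega>)"
      if \<omega>: "\<omega> \<in> space M" for \<omega>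
    proof -
      define s where "s = \<sigma> * xi X i * \<eta>"
      have s: "0 < s" unfolding s_def using \<sigma> xi \<eta> by simp
      have z: "\<theta> $ (i - 1) = s * z" unfolding z_def s_def[symmetric] using s by simp
      have "\<sigma> * xi X i / sqrt (real n) * G \<omega> = s * U \<omega>"
        unfolding s_def U_def c_def using \<eta> by simp
      then have LS': "theta_LS X (Y \<omega>) $ (i - 1) = s * (U \<omega> + z)"
        unfolding LS[OF \<omega>] z by (simp add: algebra_simps)
      have S': "sigma_hat X (Y \<omega>) * xi X i * \<eta> = s * sqrt (Q \<omega> / real (n - k))"
        unfolding S[OF \<omega>] s_def by simp
      have "\<bar>s * (U \<omega> + z)\<bar> > s * sqrt (Q \<omega> / real (n - k)) \<longleftrightarrow> \<omega> \<notin> K"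
        using s \<omega> unfolding K_def by (auto simp: abs_mult)
      then have "theta_H X \<eta> i (Y \<omega>) - \<theta> $ (i - 1) = s * (if \<omega> \<in> K then - z else U \<omega>)"
        unfolding theta_H_def LS' S' z by (simp add: algebra_simps)
      moreover have "inverse \<sigma> * inverse (xi X i * \<eta>) = inverse s"
        by (simp add: s_def)
      ultimately show ?thesis using s by simp
    qed
    have "distr M borel (\<lambda>\<omega>. inverse \<sigma> * inverse (xi X i * \<eta>) * (theta_H X \<eta> i (Y \<omega>) - \<theta> $ (i - 1)))
        = distr M borel (\<lambda>\<omega>. if \<omega> \<in> K then - z else U \<omega>)"
      by (rule distr_cong[OF refl refl Z])
    moreover have "(\<lambda>\<omega>. if \<omega> \<in> K then - z else U \<omega>) \<in> borel_measurable M" by measurable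
    ultimately show "cdf (distr M borel (\<lambda>\<omega>. inverse \<sigma> * inverse (xi X i * \<eta>) * (theta_H X \<eta> i (Y \<omega>) - \<theta> $ (i - 1)))) x
       = measure M {\<omega> \<in> space M. (if \<omega> \<in> K then - z else U \<omega>) \<le> x}"
      unfolding cdf_def2 by (simp only:) (subst measure_distr, auto intro!: arg_cong[where f = "measure M"])
  qed
qed

lemma std_normal_scaled_tail:
  assumes c: "filterlim c at_top sequentially" and \<epsilon>: "0 < \<epsilon>"
  shows "(\<lambda>n. measure std_normal_distribution {g. \<epsilon> < \<bar>g / c n\<bar>}) \<longlonglongrightarrow> 0"
proof -
  have "(\<lambda>n. LINT g|std_normal_distribution. indicator {g. \<epsilon> < \<bar>g / c n\<bar>} g :: real) \<longlonglongrightarrow> (LINT g|std_normal_distribution. 0)"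
  proof (rule integral_dominated_convergence[where w = "\<lambda>_. 1"])
    show "AE g in std_normal_distribution. (\<lambda>n. indicator {g. \<epsilon> < \<bar>g / c n\<bar>} g :: real) \<longlonglongrightarrow> 0"
    proof (rule AE_I2)
      fix g
      have "(\<lambda>n. \<bar>g / c n\<bar>) \<longlonglongrightarrow> \<bar>0\<bar>"
        by (intro tendsto_rabs tendsto_divide_0[OF tendsto_const filterlim_at_top_imp_at_infinity[OF c]])
      then have "\<forall>\<^sub>F n in sequentially. \<bar>g / c n\<bar> < \<epsilon>" by (rule order_tendstoD) (use \<epsilon> in simp)
      then have "\<forall>\<^sub>F n in sequentially. 0 = (indicator {g. \<epsilon> < \<bar>g / c n\<bar>} g :: real)"
        by eventually_elim (simp add: indicator_def)
      with tendsto_const show "(\<lambda>n. indicator {g. \<epsilon> < \<bar>g / c n\<bar>} g :: real) \<longlonglongrightarrow> 0"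
        by (rule Lim_transform_eventually)
    qed
  qed (auto simp: indicator_def)
  then show ?thesis by simp
qed

section \<open>Asymptotic distribution of the hard-thresholding estimator\<close>

theorem theorem36:
  fixes k :: "nat \<Rightarrow> nat"
    and X :: "nat \<Rightarrow> real mat"
    and \<eta> :: "nat \<Rightarrow> nat \<Rightarrow> real"
    and \<theta> :: "nat \<Rightarrow> real vec"
    and \<sigma> :: "nat \<Rightarrow> real"
    and M :: "nat \<Rightarrow> 'w measure"
    and u Y :: "nat \<Rightarrow> 'w \<Rightarrow> real vec"
    and i :: nat
    and \<zeta> :: ereal
    and \<alpha> r :: "nat \<Rightarrow> real"
    and H :: "nat \<Rightarrow> real \<Rightarrow> real"
  assumes k: "\<And>n. n \<ge> 2 \<Longrightarrow> 1 \<le> k n \<and> k n < n"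
    and X: "\<And>n. n \<ge> 2 \<Longrightarrow> X n \<in> carrier_mat n (k n)"
    and rank_X: "\<And>n. n \<ge> 2 \<Longrightarrow> vec_space.rank n (X n) = k n"
    and \<theta>: "\<And>n. n \<ge> 2 \<Longrightarrow> \<theta> n \<in> carrier_vec (k n)"
    and \<sigma>: "\<And>n. n \<ge> 2 \<Longrightarrow> 0 < \<sigma> n"
    and M: "\<And>n. n \<ge> 2 \<Longrightarrow> prob_space (M n)"
    and u: "\<And>n. n \<ge> 2 \<Longrightarrow> gaussian_errors (M n) n (\<sigma> n) (u n)"
    and Y: "\<And>n \<omega>. n \<ge> 2 \<Longrightarrow> \<omega> \<in> space (M n) \<Longrightarrow> Y n \<omega> = X n *\<^sub>v \<theta> n + u n \<omega>"
    and \<eta>: "\<And>n j. n \<ge> 2 \<Longrightarrow> 1 \<le> j \<Longrightarrow> j \<le> k n \<Longrightarrow> 0 < \<eta> j n"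
    and standing: "\<And>j. 1 \<le> j \<Longrightarrow> (\<forall>\<^sub>F n in sequentially. j \<le> k n) \<Longrightarrow>
          bdd_above ((\<lambda>n. (xi (X n) j)\<^sup>2 / real n) ` {n. 2 \<le> n \<and> j \<le> k n})"
    and i: "1 \<le> i" "\<forall>\<^sub>F n in sequentially. i \<le> k n"
    and xi_eta: "(\<lambda>n. xi (X n) i * \<eta> i n) \<longlonglongrightarrow> 0"
    and sqrt_eta: "filterlim (\<lambda>n. sqrt (real n) * \<eta> i n) at_top sequentially"
    and \<alpha>: "\<And>n. \<alpha> n = inverse (xi (X n) i * \<eta> i n)"
    and \<zeta>: "(\<lambda>n. ereal (\<theta> n $ (i - 1) / (\<sigma> n * xi (X n) i * \<eta> i n))) \<longlonglongrightarrow> \<zeta>"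
    and H: "\<And>n. H n = cdf (distr (M n) borel
          (\<lambda>\<omega>. inverse (\<sigma> n) * \<alpha> n * (theta_H (X n) (\<eta> i n) i (Y n \<omega>) - \<theta> n $ (i - 1))))"
    and r: "\<And>n. r n = sqrt (real n) *
          (\<eta> i n - real_of_ereal \<zeta> * (\<theta> n $ (i - 1)) / (\<sigma> n * xi (X n) i))"
  shows
    "(\<forall>m. (\<forall>\<^sub>F n in sequentially. n - k n = m) \<longrightarrow>
        weak_conv H (cdf (mixture (LBINT s=\<bar>\<zeta>\<bar>..\<infinity>. rho m s) (pointmass (- \<zeta>))
                                  (1 - (LBINT s=\<bar>\<zeta>\<bar>..\<infinity>. rho m s)) (pointmass 0))) \<and>
        (LBINT s=\<bar>\<zeta>\<bar>..\<infinity>. rho m s) =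
          measure (chi_square m) {x. ereal x > ereal (real m) * \<zeta>\<^sup>2} \<and>
        1 - (LBINT s=\<bar>\<zeta>\<bar>..\<infinity>. rho m s) =
          measure (chi_square m) {x. ereal x \<le> ereal (real m) * \<zeta>\<^sup>2} \<and>
        (\<bar>\<zeta>\<bar> = \<infinity> \<longrightarrow>
          mixture (LBINT s=\<bar>\<zeta>\<bar>..\<infinity>. rho m s) (pointmass (- \<zeta>))
                  (1 - (LBINT s=\<bar>\<zeta>\<bar>..\<infinity>. rho m s)) (pointmass 0) = pointmass 0)) \<and>
     (filterlim (\<lambda>n. n - k n) at_top sequentially \<longrightarrow>
        (\<bar>\<zeta>\<bar> < 1 \<longrightarrow> weak_conv H (cdf (pointmass (- \<zeta>)))) \<and>
        (\<bar>\<zeta>\<bar> > 1 \<longrightarrow> weak_conv H (cdf (pointmass 0))) \<and>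
        (\<forall>r0 :: ereal. \<bar>\<zeta>\<bar> = 1 \<and>
            (\<lambda>n. sqrt (real n) * \<eta> i n / sqrt (real (n - k n))) \<longlonglongrightarrow> 0 \<and>
            (\<lambda>n. ereal (r n)) \<longlonglongrightarrow> r0 \<longrightarrow>
          weak_conv H (cdf (mixture (Phi r0) (pointmass (- \<zeta>)) (1 - Phi r0) (pointmass 0)))) \<and>
        (\<forall>d (r0 :: ereal). \<bar>\<zeta>\<bar> = 1 \<and> 0 < d \<and>
            (\<lambda>n. sqrt (real n) * \<eta> i n / sqrt (real (n - k n))) \<longlonglongrightarrow> sqrt 2 * d \<and>
            (\<lambda>n. ereal (r n)) \<longlonglongrightarrow> r0 \<longrightarrow>
          weak_conv H (cdf (mixture
              (LBINT t. Phi (ereal (d * t) + r0) * std_normal_density t) (pointmass (- \<zeta>))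
              (1 - (LBINT t. Phi (ereal (d * t) + r0) * std_normal_density t)) (pointmass 0))) \<and>
          (r0 = \<infinity> \<longrightarrow> mixture
              (LBINT t. Phi (ereal (d * t) + r0) * std_normal_density t) (pointmass (- \<zeta>))
              (1 - (LBINT t. Phi (ereal (d * t) + r0) * std_normal_density t)) (pointmass 0)
            = pointmass (- \<zeta>)) \<and>
          (r0 = -\<infinity> \<longrightarrow> mixture
              (LBINT t. Phi (ereal (d * t) + r0) * std_normal_density t) (pointmass (- \<zeta>))
              (1 - (LBINT t. Phi (ereal (d * t) + r0) * std_normal_density t)) (pointmass 0)
            = pointmass 0)) \<and>
        (\<forall>r' :: ereal. \<bar>\<zeta>\<bar> = 1 \<and>
            filterlim (\<lambda>n. sqrt (real n) * \<eta> i n / sqrt (real (n - k n))) at_top sequentially \<and>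
            (\<lambda>n. ereal (inverse (sqrt (real n) * \<eta> i n / sqrt (real (n - k n))) * r n))
              \<longlonglongrightarrow> ereal (inverse (sqrt 2)) * r' \<longrightarrow>
          weak_conv H (cdf (mixture (Phi r') (pointmass (- \<zeta>)) (1 - Phi r') (pointmass 0)))))"
proof -
  define \<nu> where "\<nu> n = n - k n" for n
  define c where "c n = sqrt (real n) * \<eta> i n" for n
  define z where "z n = \<theta> n $ (i - 1) / (\<sigma> n * xi (X n) i * \<eta> i n)" for n
  have c: "filterlim c at_top sequentially" unfolding c_def by (rule sqrt_eta)
  have z: "(\<lambda>n. ereal (z n)) \<longlonglongrightarrow> \<zeta>" unfolding z_def by (rule \<zeta>)
  have ev: "\<forall>\<^sub>F n in sequentially. 2 \<le> n \<and> i \<le> k n"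
    using i(2) eventually_ge_at_top[of 2] by eventually_elim simp
  define represents where "represents n K U \<longleftrightarrow> K \<in> sets (M n) \<and> U \<in> borel_measurable (M n) \<and>
      (\<forall>\<epsilon>. measure (M n) {\<omega> \<in> space (M n). \<epsilon> < \<bar>U \<omega>\<bar>} = measure std_normal_distribution {g. \<epsilon> < \<bar>g / c n\<bar>}) \<and>
      measure (M n) K = zero_prob (\<nu> n) (c n) (z n) \<and>
      (\<forall>x. H n x = measure (M n) {\<omega> \<in> space (M n). (if \<omega> \<in> K then - z n else U \<omega>) \<le> x})" for n K U
  have "\<exists>K U. represents n K U" if n: "2 \<le> n" "i \<le> k n" for n
  proof -
    interpret prob_space "M n" using M n by simp
    have kn: "k n < n" using k[OF n(1)] by simp
    show ?thesis
    proof (rule hard_threshold_representation[OF X[OF n(1)] rank_X[OF n(1)] kn i(1) n(2) \<theta>[OF n(1)]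
          \<sigma>[OF n(1)] u[OF n(1)] Y[OF n(1)] \<eta>[OF n(1) i(1) n(2)]])
      fix K U
      assume KU: "K \<in> sets (M n)" "U \<in> borel_measurable (M n)"
        "\<And>\<epsilon>. measure (M n) {\<omega> \<in> space (M n). \<epsilon> < \<bar>U \<omega>\<bar>} =
          measure std_normal_distribution {g. \<epsilon> < \<bar>g / (sqrt (real n) * \<eta> i n)\<bar>}"
        "measure (M n) K = zero_prob (n - k n) (sqrt (real n) * \<eta> i n) (\<theta> n $ (i - 1) / (\<sigma> n * xi (X n) i * \<eta> i n))"
        "\<And>x. cdf (distr (M n) borel (\<lambda>\<omega>. inverse (\<sigma> n) * inverse (xi (X n) i * \<eta> i n) *
            (theta_H (X n) (\<eta> i n) i (Y n \<omega>) - \<theta> n $ (i - 1)))) x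
          = measure (M n) {\<omega> \<in> space (M n).
              (if \<omega> \<in> K then - (\<theta> n $ (i - 1) / (\<sigma> n * xi (X n) i * \<eta> i n)) else U \<omega>) \<le> x}"
      show ?thesis
        unfolding represents_def H \<alpha> \<nu>_def c_def z_def
        by (rule exI[of _ K], rule exI[of _ U]) (intro conjI allI KU)
    qed
  qed
  then obtain K U where KU: "\<And>n. 2 \<le> n \<and> i \<le> k n \<Longrightarrow> represents n (K n) (U n)"
    by metis
  have K_sets: "K n \<in> sets (M n)" and U_measurable: "U n \<in> borel_measurable (M n)"
    and U_tail: "measure (M n) {\<omega> \<in> space (M n). \<epsilon> < \<bar>U n \<omega>\<bar>} = measure std_normal_distribution {g. \<epsilon> < \<bar>g / c n\<bar>}"
    and K_prob: "measure (M n) (K n) = zero_prob (\<nu> n) (c n) (z n)"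
    and H_eq: "H n x = measure (M n) {\<omega> \<in> space (M n). (if \<omega> \<in> K n then - z n else U n \<omega>) \<le> x}"
    if "2 \<le> n \<and> i \<le> k n" for n \<epsilon> x
    using KU[OF that] unfolding represents_def by simp_all
  have conv: "weak_conv H (cdf (mixture w (pointmass (- \<zeta>)) (1 - w) (pointmass 0)))"
    if w: "(\<lambda>n. zero_prob (\<nu> n) (c n) (z n)) \<longlonglongrightarrow> w" and inf: "\<bar>\<zeta>\<bar> = \<infinity> \<Longrightarrow> w = 0" for w
  proof (rule weak_conv_two_point[where M = M and K = K and U = U, OF _ _ _ z inf])
    show "\<forall>\<^sub>F n in sequentially. prob_space (M n) \<and> K n \<in> sets (M n) \<and> U n \<in> borel_measurable (M n)"
      using ev by eventually_elim (simp add: M K_sets U_measurable)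
    show "(\<lambda>n. measure (M n) {\<omega> \<in> space (M n). \<epsilon> < \<bar>U n \<omega>\<bar>}) \<longlonglongrightarrow> 0" if "0 < \<epsilon>" for \<epsilon>
      by (rule Lim_transform_eventually[OF std_normal_scaled_tail[OF c that]])
         (use ev in eventually_elim, rule U_tail[symmetric])
    show "(\<lambda>n. measure (M n) (K n)) \<longlonglongrightarrow> w"
      by (rule Lim_transform_eventually[OF w]) (use ev in eventually_elim, rule K_prob[symmetric])
    show "\<forall>\<^sub>F n in sequentially. \<forall>x. H n x = measure (M n) {\<omega> \<in> space (M n). (if \<omega> \<in> K n then - z n else U n \<omega>) \<le> x}"
      using ev by eventually_elim (intro allI H_eq)
  qed
  have fixed_df: "weak_conv H (cdf (mixture (LBINT s=\<bar>\<zeta>\<bar>..\<infinity>. rho m s) (pointmass (- \<zeta>))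
                                  (1 - (LBINT s=\<bar>\<zeta>\<bar>..\<infinity>. rho m s)) (pointmass 0))) \<and>
        (LBINT s=\<bar>\<zeta>\<bar>..\<infinity>. rho m s) =
          measure (chi_square m) {x. ereal x > ereal (real m) * \<zeta>\<^sup>2} \<and>
        1 - (LBINT s=\<bar>\<zeta>\<bar>..\<infinity>. rho m s) =
          measure (chi_square m) {x. ereal x \<le> ereal (real m) * \<zeta>\<^sup>2} \<and>
        (\<bar>\<zeta>\<bar> = \<infinity> \<longrightarrow>
          mixture (LBINT s=\<bar>\<zeta>\<bar>..\<infinity>. rho m s) (pointmass (- \<zeta>))
                  (1 - (LBINT s=\<bar>\<zeta>\<bar>..\<infinity>. rho m s)) (pointmass 0) = pointmass 0)"
    if "\<forall>\<^sub>F n in sequentially. n - k n = m" for m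
  proof -
    have "\<forall>\<^sub>F n in sequentially. \<nu> n = m \<and> 2 \<le> n"
      using that eventually_ge_at_top[of 2] by eventually_elim (simp add: \<nu>_def)
    then obtain n where "\<nu> n = m" "2 \<le> n"
      using eventually_happens'[OF sequentially_bot] by blast
    then have m: "1 \<le> m" using k[of n] by (auto simp: \<nu>_def)
    define w where "w = measure (chi_square m) {x. ereal x > ereal (real m) * \<zeta>\<^sup>2}"
    have rho: "(LBINT s=\<bar>\<zeta>\<bar>..\<infinity>. rho m s) = w" unfolding w_def by (rule LBINT_rho[OF m])
    have compl: "1 - w = measure (chi_square m) {x. ereal x \<le> ereal (real m) * \<zeta>\<^sup>2}"
    proof -
      have "{x. ereal x \<le> ereal (real m) * \<zeta>\<^sup>2} = UNIV - {x. ereal x > ereal (real m) * \<zeta>\<^sup>2}" by auto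
      then show ?thesis
        using chi_square.prob_compl[of "{x. ereal x > ereal (real m) * \<zeta>\<^sup>2}" m] chi_square.space_eq_univ
        unfolding w_def by simp
    qed
    have w_inf: "w = 0" if "\<bar>\<zeta>\<bar> = \<infinity>"
    proof -
      have "ereal (real m) * \<zeta>\<^sup>2 = \<infinity>"
        using that m by (cases \<zeta>) (simp_all add: power2_eq_square)
      then show ?thesis unfolding w_def by simp
    qed
    have "(\<lambda>n. zero_prob (\<nu> n) (c n) (z n)) \<longlonglongrightarrow> w"
      by (rule Lim_transform_eventually[OF zero_prob_fixed_df[OF m c z, folded w_def]])
         (use that in eventually_elim, simp add: \<nu>_def)
    from conv[OF this w_inf] show ?thesis
      using w_inf unfolding rho compl[symmetric] w_def[symmetric] by (simp add: mixture_zero_one)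
  qed
  have inside: "weak_conv H (cdf (pointmass (- \<zeta>)))" if \<nu>: "filterlim \<nu> at_top sequentially" and "\<bar>\<zeta>\<bar> < 1"
  proof -
    have "\<bar>\<zeta>\<bar> \<noteq> \<infinity>" using that(2) by auto
    with conv[OF zero_prob_inside[OF \<nu> c z that(2)]] show ?thesis by (simp add: mixture_one_zero)
  qed
  have outside: "weak_conv H (cdf (pointmass 0))" if \<nu>: "filterlim \<nu> at_top sequentially" and "\<bar>\<zeta>\<bar> > 1"
    using conv[OF zero_prob_outside[OF \<nu> c z that(2)]] by (simp add: mixture_zero_one)
  \<comment> \<open>On the boundary \<open>s = \<plusminus> 1\<close>, and \<open>z\<close> is reflected so that its limit becomes 1; this turns \<open>r\<close> into \<open>c (1 - z')\<close>.\<close>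
  define s where "s = real_of_ereal \<zeta>"
  define z' where "z' n = s * z n" for n
  have z': "z' \<longlonglongrightarrow> 1" and reflect: "zero_prob m b (z' n) = zero_prob m b (z n)" if "\<bar>\<zeta>\<bar> = 1" for m b n
  proof -
    have s: "\<zeta> = ereal s" using that by (cases \<zeta>) (simp_all add: s_def)
    have s1: "s = 1 \<or> s = - 1" using that unfolding s by (simp add: one_ereal_def abs_if split: if_splits)
    have "z \<longlonglongrightarrow> s" using z unfolding s by simp
    then have "z' \<longlonglongrightarrow> s * s" unfolding z'_def by (rule tendsto_mult_left)
    then show "z' \<longlonglongrightarrow> 1" using s1 by auto
    show "zero_prob m b (z' n) = zero_prob m b (z n)"
      using s1 zero_prob_reflect[of m b "z n"] unfolding z'_def by auto
  qed
  have r_eq: "\<forall>\<^sub>F n in sequentially. r n = c n * (1 - z' n)"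
    using ev
  proof eventually_elim
    case (elim n)
    then have \<eta>0: "\<eta> i n \<noteq> 0" using \<eta>[of n i] i(1) by auto
    have cancel: "e * (t / (b * e)) = t / b" if "e \<noteq> 0" for e t b :: real
      using that by simp
    show ?case
      unfolding r c_def z'_def z_def s_def[symmetric]
      using cancel[OF \<eta>0, of "\<theta> n $ (i - 1)" "\<sigma> n * xi (X n) i"] \<eta>0
      by (simp add: algebra_simps)
  qed
  have boundary: "weak_conv H (cdf (mixture w (pointmass (- \<zeta>)) (1 - w) (pointmass 0)))"
    if "\<bar>\<zeta>\<bar> = 1" "(\<lambda>n. zero_prob (\<nu> n) (c n) (z' n)) \<longlonglongrightarrow> w" for w
    using conv[of w] that reflect by auto
  have r_lim: "(\<lambda>n. ereal (c n * (1 - z' n))) \<longlonglongrightarrow> r0" if "(\<lambda>n. ereal (r n)) \<longlonglongrightarrow> r0" for r0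
    by (rule Lim_transform_eventually[OF that]) (use r_eq in eventually_elim, simp)
  have slow: "weak_conv H (cdf (mixture (Phi r0) (pointmass (- \<zeta>)) (1 - Phi r0) (pointmass 0)))"
    if \<nu>: "filterlim \<nu> at_top sequentially" and "\<bar>\<zeta>\<bar> = 1" "(\<lambda>n. c n / sqrt (real (\<nu> n))) \<longlonglongrightarrow> 0"
      "(\<lambda>n. ereal (r n)) \<longlonglongrightarrow> r0" for r0
    by (rule boundary[OF that(2) zero_prob_boundary_slow[OF \<nu> c z'[OF that(2)] that(3) r_lim[OF that(4)]]])
  have balanced: "weak_conv H (cdf (mixture (LBINT t. Phi (ereal (d * t) + r0) * std_normal_density t) (pointmass (- \<zeta>))
        (1 - (LBINT t. Phi (ereal (d * t) + r0) * std_normal_density t)) (pointmass 0)))"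
    if \<nu>: "filterlim \<nu> at_top sequentially" and "\<bar>\<zeta>\<bar> = 1" "0 < d" "(\<lambda>n. c n / sqrt (real (\<nu> n))) \<longlonglongrightarrow> sqrt 2 * d"
      "(\<lambda>n. ereal (r n)) \<longlonglongrightarrow> r0" for d r0
    by (rule boundary[OF that(2) zero_prob_boundary_balanced[OF \<nu> c z'[OF that(2)] that(3,4) r_lim[OF that(5)]]])
  have fast: "weak_conv H (cdf (mixture (Phi r') (pointmass (- \<zeta>)) (1 - Phi r') (pointmass 0)))"
    if \<nu>: "filterlim \<nu> at_top sequentially" and "\<bar>\<zeta>\<bar> = 1" "filterlim (\<lambda>n. c n / sqrt (real (\<nu> n))) at_top sequentially"
      "(\<lambda>n. ereal (inverse (c n / sqrt (real (\<nu> n))) * r n)) \<longlonglongrightarrow> ereal (inverse (sqrt 2)) * r'" for r'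
  proof (rule boundary[OF that(2) zero_prob_boundary_fast[OF \<nu> c z'[OF that(2)] that(3)]])
    show "(\<lambda>n. ereal (inverse (c n / sqrt (real (\<nu> n))) * (c n * (1 - z' n)))) \<longlonglongrightarrow> ereal (inverse (sqrt 2)) * r'"
      by (rule Lim_transform_eventually[OF that(4)]) (use r_eq in eventually_elim, simp)
  qed
  have mixing_infty: "(LBINT t. Phi (ereal (d * t) + \<infinity>) * std_normal_density t) = 1"
    and mixing_minus_infty: "(LBINT t. Phi (ereal (d * t) + (- \<infinity>)) * std_normal_density t) = 0"
    if "0 < d" for d
    using Phi_mixing_integral[OF that] std_normal.prob_space by simp_all
  show ?thesis
  proof (rule conjI, intro allI impI, rule fixed_df, assumption, intro allI impI conjI; (elim conjE)?)
    assume "filterlim (\<lambda>n. n - k n) at_top sequentially"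
    then have \<nu>: "filterlim \<nu> at_top sequentially" unfolding \<nu>_def .
    show "weak_conv H (cdf (pointmass (- \<zeta>)))" if "\<bar>\<zeta>\<bar> < 1" by (rule inside[OF \<nu> that])
    show "weak_conv H (cdf (pointmass 0))" if "\<bar>\<zeta>\<bar> > 1" by (rule outside[OF \<nu> that])
    show "weak_conv H (cdf (mixture (Phi r0) (pointmass (- \<zeta>)) (1 - Phi r0) (pointmass 0)))"
      if "\<bar>\<zeta>\<bar> = 1" "(\<lambda>n. sqrt (real n) * \<eta> i n / sqrt (real (n - k n))) \<longlonglongrightarrow> 0" "(\<lambda>n. ereal (r n)) \<longlonglongrightarrow> r0" for r0
      by (rule slow[OF \<nu> that(1) _ that(3)]) (use that(2) in \<open>simp only: c_def \<nu>_def\<close>)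
    fix d :: real and r0 :: ereal
    assume a: "\<bar>\<zeta>\<bar> = 1" "0 < d" "(\<lambda>n. sqrt (real n) * \<eta> i n / sqrt (real (n - k n))) \<longlonglongrightarrow> sqrt 2 * d"
      "(\<lambda>n. ereal (r n)) \<longlonglongrightarrow> r0"
    show "weak_conv H (cdf (mixture (LBINT t. Phi (ereal (d * t) + r0) * std_normal_density t) (pointmass (- \<zeta>))
        (1 - (LBINT t. Phi (ereal (d * t) + r0) * std_normal_density t)) (pointmass 0)))"
      by (rule balanced[OF \<nu> a(1,2) _ a(4)]) (use a(3) in \<open>simp only: c_def \<nu>_def\<close>)
    show "mixture (LBINT t. Phi (ereal (d * t) + r0) * std_normal_density t) (pointmass (- \<zeta>))
        (1 - (LBINT t. Phi (ereal (d * t) + r0) * std_normal_density t)) (pointmass 0) = pointmass (- \<zeta>)"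
      if "r0 = \<infinity>"
      unfolding that mixing_infty[OF a(2)] by (simp add: mixture_one_zero)
    show "mixture (LBINT t. Phi (ereal (d * t) + r0) * std_normal_density t) (pointmass (- \<zeta>))
        (1 - (LBINT t. Phi (ereal (d * t) + r0) * std_normal_density t)) (pointmass 0) = pointmass 0"
      if "r0 = - \<infinity>"
      unfolding that mixing_minus_infty[OF a(2)] by (simp add: mixture_zero_one)
  next
    assume "filterlim (\<lambda>n. n - k n) at_top sequentially"
    then have \<nu>: "filterlim \<nu> at_top sequentially" unfolding \<nu>_def .
    fix r' :: ereal
    assume a: "\<bar>\<zeta>\<bar> = 1" "filterlim (\<lambda>n. sqrt (real n) * \<eta> i n / sqrt (real (n - k n))) at_top sequentially"
      "(\<lambda>n. ereal (inverse (sqrt (real n) * \<eta> i n / sqrt (real (n - k n))) * r n)) \<longlonglongrightarrow> ereal (inverse (sqrt 2)) * r'"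
    show "weak_conv H (cdf (mixture (Phi r') (pointmass (- \<zeta>)) (1 - Phi r') (pointmass 0)))"
      by (rule fast[OF \<nu> a(1)]) (use a(2,3) in \<open>simp_all only: c_def \<nu>_def\<close>)
  qed
qed

end
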